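(* Let $k\ge3$. (1) If $k$ is not a perfect square, $(V_L^+(1)+C_2(V_L^+))/C_2(V_L^+)$ is spanned by the classes of $L(-2)^sE$, $s\ge0$. (2) If $k$ is a perfect square, $(V_L^+(1)+C_2(V_L^+))/C_2(V_L^+)$ is spanned by the classes of $L(-2)^sJ_{-1}^tE$, $s,t\ge0$.
   Context: $L=\mathbb{Z}\alpha$, $\langle\alpha,\alpha\rangle=2k$; $V_L=M(1)\otimes\mathbb{C}[L]$ the lattice VOA with conformal vector $\omega=\frac1{4k}\alpha(-1)^2\mathbf1$, $L(n)=\omega_{n+1}$; $V_L^+$ the fixed points of the involution $\theta$ lifted from $-1$ on $L$, $M(1)^{\pm}$ its $\pm1$-eigenspaces on $M(1)$; $E=e^{\alpha}+e^{-\alpha}$, $F=e^\alpha-e^{-\alpha}$, $V_L^+(1)=M(1)^+\otimes E\oplus M(1)^-\otimes F$. $J=\frac{1}{4k^2}\alpha(-1)^4\mathbf1-\frac1k\alpha(-3)\alpha(-1)\mathbf1+\frac{3}{4k}\alpha(-2)^2\mathbf1$, $J_{-1}$ its $(-1)$-mode; powers are operator powers. $C_2(V)$ is the span of $\{v_{-2}u:u,v\in V\}$. *)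

theory Defs
  imports Complex_Main "HOL-Library.Multiset"
begin

text \<open>Concrete model of the rank one lattice VOA V_L, L = Z alpha, <alpha,alpha> = 2k.
  A basis vector alpha(-n1)...alpha(-nr) e^(c alpha) (all ni >= 1) is encoded as the pair
  (multiset of the ni, c).  Vectors are finitely supported functions basis => complex.
  The cocycle is taken trivial (allowed since <alpha,alpha> is even).\<close>

type_synonym basis = "nat multiset \<times> int"
type_synonym vec = "basis \<Rightarrow> complex"

definition bv :: "basis \<Rightarrow> vec" where
  "bv b = (\<lambda>x. if x = b then 1 else 0)"

definition smult :: "complex \<Rightarrow> vec \<Rightarrow> vec" where
  "smult a v = (\<lambda>x. a * v x)"

definition vadd :: "vec \<Rightarrow> vec \<Rightarrow> vec" where
  "vadd u v = (\<lambda>x. u x + v x)"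

definition supp :: "vec \<Rightarrow> basis set" where
  "supp v = {x. v x \<noteq> 0}"

definition lift :: "(basis \<Rightarrow> vec) \<Rightarrow> vec \<Rightarrow> vec" where
  "lift f v = (\<lambda>x. \<Sum>b\<in>supp v. v b * f b x)"

text \<open>Heisenberg modes alpha(j) on basis vectors, [alpha(m),alpha(n)] = 2k m delta_{m+n,0},
  alpha(0) e^(c alpha) = 2k c e^(c alpha).\<close>
definition alpha_b :: "nat \<Rightarrow> int \<Rightarrow> basis \<Rightarrow> vec" where
  "alpha_b k j b = (case b of (M, c) \<Rightarrow>
     if j < 0 then bv (add_mset (nat (- j)) M, c)
     else if j = 0 then smult (of_int (2 * int k * c)) (bv (M, c))
     else smult (of_int (2 * int k * j) * of_nat (count M (nat j))) (bv (M - {#nat j#}, c)))"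

definition amode :: "nat \<Rightarrow> int \<Rightarrow> vec \<Rightarrow> vec" where
  "amode k j = lift (alpha_b k j)"

definition shiftL :: "int \<Rightarrow> vec \<Rightarrow> vec" where
  "shiftL b = lift (\<lambda>(M, c). bv (M, c + b))"

definition partitions :: "nat \<Rightarrow> nat multiset set" where
  "partitions l = {P. (\<forall>m\<in>#P. 0 < m) \<and> sum_mset P = l}"

definition expcoef :: "complex \<Rightarrow> nat multiset \<Rightarrow> complex" where
  "expcoef a P = (\<Prod>m\<in>set_mset P. (a / of_nat m) ^ (count P m) / of_nat (fact (count P m)))"

text \<open>Coefficient of z^(-l) in exp(- sum_{m>0} beta(m) z^(-m)/m), beta = b alpha.\<close>
definition Splus :: "nat \<Rightarrow> int \<Rightarrow> nat \<Rightarrow> vec \<Rightarrow> vec" where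
  "Splus k b l v = (\<lambda>x. \<Sum>P\<in>partitions l.
      expcoef (of_int (- b)) P * fold (\<lambda>m. amode k (int m)) (sorted_list_of_multiset P) v x)"

text \<open>Coefficient of z^i in exp(sum_{m>0} beta(-m) z^m/m), beta = b alpha.\<close>
definition Sminus :: "nat \<Rightarrow> int \<Rightarrow> nat \<Rightarrow> vec \<Rightarrow> vec" where
  "Sminus k b i v = (\<lambda>x. \<Sum>P\<in>partitions i.
      expcoef (of_int b) P * fold (\<lambda>m. amode k (- int m)) (sorted_list_of_multiset P) v x)"

text \<open>Y(alpha(-m1)..alpha(-mr) e^beta, z) = : prod_t d^(m_t - 1) alpha(z)/(m_t - 1)!  Y(e^beta,z) :,
  Y(e^beta,z) = E^-(-beta,z) E^+(-beta,z) e_beta z^beta,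
  with d^(m-1) alpha(z)/(m-1)! = sum_j binom(-j-1, m-1) alpha(j) z^(-j-m), normal ordering putting
  alpha(j), j<0, to the left and alpha(j), j>=0, to the right.
  A term of the full expansion of Y(v,z)w is indexed by (js, i, l): the mode j_t chosen in
  the t-th Heisenberg factor, the z^i term of E^- and the z^(-l) term of E^+.
  mode_term gives its contribution to the coefficient of z^(-p-1), i.e. to v_p w.\<close>
definition mode_term :: "nat \<Rightarrow> basis \<Rightarrow> int \<Rightarrow> basis \<Rightarrow> int list \<times> nat \<times> nat \<Rightarrow> vec" where
  "mode_term k vb p wb x = (case vb of (Mv, b) \<Rightarrow> case wb of (Mw, c) \<Rightarrow> case x of (js, i, l) \<Rightarrow>
     (let ms = sorted_list_of_multiset Mv; r = length ms in
      if length js = r \<and>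
         (\<Sum>t<r. - (js ! t) - int (ms ! t)) + int i - int l + 2 * int k * b * c = - p - 1
      then smult (\<Prod>t<r. (of_int (- (js ! t) - 1) gchoose (ms ! t - 1)))
             (fold (amode k) (filter (\<lambda>j. j < 0) js)
               (Sminus k b i (shiftL b (Splus k b l
                  (fold (amode k) (filter (\<lambda>j. 0 \<le> j) js) (bv (Mw, c)))))))
      else (\<lambda>_. 0)))"

text \<open>The (finitely many) nonzero terms are summed.\<close>
definition mode_basis :: "nat \<Rightarrow> basis \<Rightarrow> int \<Rightarrow> basis \<Rightarrow> vec" where
  "mode_basis k vb p wb =
     (\<lambda>y. \<Sum>x\<in>{x. mode_term k vb p wb x \<noteq> (\<lambda>_. 0)}. mode_term k vb p wb x y)"

text \<open>vmode k u p v = u_p v, where Y(u,z) = sum_p u_p z^(-p-1).\<close>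
definition vmode :: "nat \<Rightarrow> vec \<Rightarrow> int \<Rightarrow> vec \<Rightarrow> vec" where
  "vmode k u p v = (\<lambda>y. \<Sum>b\<in>supp u. \<Sum>w\<in>supp v. u b * v w * mode_basis k b p w y)"

definition VL :: "vec set" where
  "VL = {v. finite (supp v) \<and> (\<forall>M c. v (M, c) \<noteq> 0 \<longrightarrow> (\<forall>n\<in>#M. 0 < n))}"

text \<open>The involution theta: alpha(-n) -> -alpha(-n), e^beta -> e^(-beta).\<close>
definition theta :: "vec \<Rightarrow> vec" where
  "theta v = (\<lambda>(M, c). (-1) ^ size M * v (M, - c))"

definition VLplus :: "vec set" where
  "VLplus = {v \<in> VL. theta v = v}"

definition M1 :: "(nat multiset \<Rightarrow> complex) set" where
  "M1 = {u. finite {M. u M \<noteq> 0} \<and> (\<forall>M. u M \<noteq> 0 \<longrightarrow> (\<forall>n\<in>#M. 0 < n))}"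

definition thetaM :: "(nat multiset \<Rightarrow> complex) \<Rightarrow> (nat multiset \<Rightarrow> complex)" where
  "thetaM u = (\<lambda>M. (-1) ^ size M * u M)"

definition M1plus where "M1plus = {u \<in> M1. thetaM u = u}"
definition M1minus where "M1minus = {u \<in> M1. thetaM u = (\<lambda>M. - u M)}"

text \<open>u \<otimes> e for u in M(1), e in C[L] (functions int => complex on c alpha).\<close>
definition tens :: "(nat multiset \<Rightarrow> complex) \<Rightarrow> (int \<Rightarrow> complex) \<Rightarrow> vec" where
  "tens u e = (\<lambda>(M, c). u M * e c)"

definition Elat :: "int \<Rightarrow> complex" where
  "Elat c = (if c = 1 \<or> c = -1 then 1 else 0)"
definition Flat :: "int \<Rightarrow> complex" where
  "Flat c = (if c = 1 then 1 else if c = -1 then -1 else 0)"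

definition Evec :: vec where
  "Evec = vadd (bv ({#}, 1)) (bv ({#}, -1))"

definition VLplus1 :: "vec set" where
  "VLplus1 = {vadd (tens u Elat) (tens u' Flat) | u u'. u \<in> M1plus \<and> u' \<in> M1minus}"

definition cspan :: "vec set \<Rightarrow> vec set" where
  "cspan S = {x. \<exists>F c. finite F \<and> F \<subseteq> S \<and> x = (\<lambda>y. \<Sum>u\<in>F. c u * u y)}"

definition ssum :: "vec set \<Rightarrow> vec set \<Rightarrow> vec set" where
  "ssum A B = {vadd a b | a b. a \<in> A \<and> b \<in> B}"

definition C2 :: "nat \<Rightarrow> vec set" where
  "C2 k = cspan {vmode k v (-2) u | u v. u \<in> VLplus \<and> v \<in> VLplus}"

definition omega :: "nat \<Rightarrow> vec" where
  "omega k = smult (1 / of_nat (4 * k)) (bv ({#1, 1#}, 0))"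

definition Lm2 :: "nat \<Rightarrow> vec \<Rightarrow> vec" where
  "Lm2 k = vmode k (omega k) (-1)"

definition Jvec :: "nat \<Rightarrow> vec" where
  "Jvec k = (\<lambda>y. 1 / of_nat (4 * k ^ 2) * bv ({#1, 1, 1, 1#}, 0) y
               - 1 / of_nat k * bv ({#3, 1#}, 0) y
               + 3 / of_nat (4 * k) * bv ({#2, 2#}, 0) y)"

definition Jm1 :: "nat \<Rightarrow> vec \<Rightarrow> vec" where
  "Jm1 k = vmode k (Jvec k) (-1)"

end

theory Submission
  imports Defs "HOL-Library.Poly_Mapping"
begin

text \<open>Restriction to charge one identifies \<open>V\<^sub>L\<^sup>+(1)\<close> with the polynomial algebra
  \<open>\<complex>[x\<^sub>1, x\<^sub>2, \<dots>]\<close>, \<open>x\<^sub>n = \<alpha>(-n)\<close>.  Two families of elements of \<open>C\<^sub>2\<close> suffice: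
  \<open>L(-1)h = h\<^sub>-\<^sub>2\<one> = x\<^sub>1 h + D h\<close> with the derivation \<open>D x\<^sub>n = n x\<^bsub>n+1\<^esub>\<close>, and
  \<open>(\<alpha>(-m)\<alpha>(-n)\<one>)\<^sub>-\<^sub>2 h = m x\<^bsub>m+1\<^esub> x\<^sub>n h + n x\<^sub>m x\<^bsub>n+1\<^esub> h\<close> up to shorter terms.
  The second shifts a product of two generators to \<open>x\<^bsub>m+n\<^esub> x\<^sub>1\<close>, which the first shortens, so
  modulo \<open>C\<^sub>2\<close> everything reduces to \<open>1\<close> and the \<open>x\<^sub>d\<close>.  Finally
  \<open>L(-2) x\<^sub>n = e\<^sub>n x\<^bsub>n+2\<^esub>\<close> modulo these relations, with \<open>e\<^sub>n \<noteq> 0\<close> because \<open>k \<ge> 3\<close>, and \<open>L(-2)\<close>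
  preserves the span of the relations; hence the \<open>L(-2)\<^sup>s e\<^sup>\<alpha>\<close> span.  This argument does not
  distinguish whether \<open>k\<close> is a square: in the square case the descendants with \<open>t = 0\<close> already
  span, and it remains to see that \<open>J\<^sub>-\<^sub>1\<close> preserves \<open>V\<^sub>L\<^sup>+(1)\<close>.\<close>

section \<open>First order operators on the charge one sector\<close>

type_synonym fock = "nat multiset \<Rightarrow>\<^sub>0 complex"

abbreviation "lookup \<equiv> Poly_Mapping.lookup"
abbreviation "keys \<equiv> Poly_Mapping.keys"

section \<open>Polynomial algebra on the variables \<open>var n\<close> and its monomial
  basis\<close>

definition cst :: "complex \<Rightarrow> fock" where
  "cst c = Poly_Mapping.single 0 c"

definition mon :: "nat multiset \<Rightarrow> fock" where
  "mon M = Poly_Mapping.single M 1"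

definition var :: "nat \<Rightarrow> fock" where
  "var n = mon {#n#}"

lemma cst_0 [simp]: "cst 0 = 0" and cst_1 [simp]: "cst 1 = 1"
  by (simp_all add: cst_def)
  
lemma cst_add: "cst (a + b) = cst a + cst b"
  by (simp add: cst_def single_add)

lemma cst_mult: "cst (a * b) = cst a * cst b"
  by (simp add: cst_def mult_single)

lemma cst_uminus: "cst (- a) = - cst a"
  by (simp add: cst_def single_uminus)

lemma cst_diff: "cst (a - b) = cst a - cst b"
  by (simp add: cst_def single_diff)

lemma cst_of_nat: "cst (of_nat n) = of_nat n"
  by (simp add: cst_def)

lemma mon_empty [simp]: "mon {#} = 1"
  using Poly_Mapping.single_one[where ?'a = "nat multiset" and ?'b = complex] by (simp add: mon_def)

lemma mon_add: "mon (M + N) = mon M * mon N"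
  by (simp add: mon_def mult_single)

lemma mon_add_mset: "mon (add_mset n M) = var n * mon M"
  using mon_add[of "{#n#}" M] by (simp add: var_def)

lemma lookup_cst_mult [simp]: "lookup (cst c * g) M = c * lookup g M"
  by (auto simp: cst_def Poly_Mapping.map.rep_eq when_def simp flip: mult_map_scale_conv_mult)

lemma lookup_mon: "lookup (mon M) N = (if N = M then 1 else 0)"
  by (auto simp: mon_def Poly_Mapping.lookup_single when_def)

lemma fock_expand: "g = (\<Sum>M\<in>keys g. cst (lookup g M) * mon M)"
  by (rule poly_mapping_eqI)
    (auto simp: lookup_sum lookup_mon if_distrib[of "\<lambda>x. _ * x"] sum.delta in_keys_iff cong: if_cong)

text \<open>The monomial case is restricted to monomials occurring in \<open>g\<close>, so that
  conditions on the support of \<open>g\<close>, such as positivity of all indices, are available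
  there.\<close>

lemma fock_induct [consumes 0, case_names zero mon cst add]:
  assumes "P 0" "\<And>M. M \<in> keys g \<Longrightarrow> P (mon M)" "\<And>c h. P h \<Longrightarrow> P (cst c * h)"
    "\<And>h h'. P h \<Longrightarrow> P h' \<Longrightarrow> P (h + h')"
  shows "P g"
proof -
  have "P (\<Sum>M\<in>A. cst (lookup g M) * mon M)" if "A \<subseteq> keys g" for A
    using finite_subset[OF that Poly_Mapping.finite_keys] that
    by (induction A rule: finite_induct) (auto intro: assms)
  from this[OF subset_refl] show ?thesis by (simp flip: fock_expand)
qed

section \<open>Linear extension and derivations\<close>

definition linext :: "(nat multiset \<Rightarrow> fock) \<Rightarrow> fock \<Rightarrow> fock" where
  "linext T g = (\<Sum>M\<in>keys g. cst (lookup g M) * T M)"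

lemma linext_superset:
  assumes "finite A" "keys g \<subseteq> A"
  shows "linext T g = (\<Sum>M\<in>A. cst (lookup g M) * T M)"
  unfolding linext_def using assms by (intro sum.mono_neutral_left) (auto simp: in_keys_iff)

lemma linext_add: "linext T (g + h) = linext T g + linext T h"
  using keys_add[of g h]
  by (subst (1 2 3) linext_superset[of "keys g \<union> keys h"])
    (auto simp: lookup_add cst_add algebra_simps sum.distrib)

lemma linext_cst: "linext T (cst c * g) = cst c * linext T g"
  by (subst (1 2) linext_superset[of "keys g"])
    (auto simp: in_keys_iff cst_mult mult.assoc sum_distrib_left)

lemma linext_mon [simp]: "linext T (mon M) = T M"
  by (simp add: linext_def lookup_mon mon_def)

text \<open>The sum over the multiset counts every occurrence of a variable, so x_n^e contributes e
  times; this is the derivation that sends x_n to \<open>\<phi> n\<close>.\<close>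

definition der :: "(nat \<Rightarrow> fock) \<Rightarrow> fock \<Rightarrow> fock" where
  "der \<phi> = linext (\<lambda>M. \<Sum>n\<in>#M. \<phi> n * mon (M - {#n#}))"

lemma der_add: "der \<phi> (g + h) = der \<phi> g + der \<phi> h"
  by (simp add: der_def linext_add)

lemma der_cst: "der \<phi> (cst c * g) = cst c * der \<phi> g"
  by (simp add: der_def linext_cst)

lemma der_mon: "der \<phi> (mon M) = (\<Sum>n\<in>#M. \<phi> n * mon (M - {#n#}))"
  by (simp add: der_def)

lemma der_var [simp]: "der \<phi> (var n) = \<phi> n"
  by (simp add: var_def der_mon)

lemma der_0 [simp]: "der \<phi> 0 = 0"
  using der_cst[of \<phi> 0] by simp

lemma der_1 [simp]: "der \<phi> 1 = 0"
  using der_mon[of \<phi> "{#}"] by simp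

lemma der_const [simp]: "der \<phi> (cst c) = 0"
  using der_cst[of \<phi> c 1] by simp

lemma der_sum: "der \<phi> (\<Sum>i\<in>I. g i) = (\<Sum>i\<in>I. der \<phi> (g i))"
  by (induction I rule: infinite_finite_induct) (auto simp: der_add)

text \<open>First step towards the Leibniz rule, which is then extended to a variable times a
  polynomial, to a monomial times a polynomial and finally to all products.\<close>

lemma der_var_mult_mon: "der \<phi> (var n * mon M) = \<phi> n * mon M + var n * der \<phi> (mon M)"
proof -
  have "mon (add_mset n M - {#m#}) = var n * mon (M - {#m#})" if "m \<in># M" for m
    using that by (auto dest!: multi_member_split simp: add_mset_commute simp flip: mon_add_mset)
  then have "(\<Sum>m\<in>#M. \<phi> m * mon (add_mset n M - {#m#})) = (\<Sum>m\<in>#M. var n * (\<phi> m * mon (M - {#m#})))"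
    by (intro arg_cong[of _ _ sum_mset] image_mset_cong) (simp add: algebra_simps)
  then show ?thesis
    by (simp add: der_mon sum_mset_distrib_left flip: mon_add_mset)
qed

lemma der_var_mult: "der \<phi> (var n * g) = \<phi> n * g + var n * der \<phi> g"
proof (induction rule: fock_induct[where g = g])
  case (mon M)
  show ?case by (rule der_var_mult_mon)
next
  case (cst c h)
  have "der \<phi> (var n * (cst c * h)) = der \<phi> (cst c * (var n * h))"
    by (simp only: mult.left_commute)
  with cst show ?case by (simp add: der_cst) (simp add: algebra_simps)
qed (simp_all add: distrib_left distrib_right der_add algebra_simps)

lemma der_mon_mult: "der \<phi> (mon M * h) = der \<phi> (mon M) * h + mon M * der \<phi> h"
proof (induction M)
  case (add n M)
  then show ?case by (simp add: mult.assoc mon_add_mset der_var_mult) (simp add: algebra_simps)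
qed simp

lemma der_mult: "der \<phi> (g * h) = der \<phi> g * h + g * der \<phi> h"
proof (induction rule: fock_induct[where g = g])
  case (mon M)
  show ?case by (rule der_mon_mult)
next
  case (cst c g)
  then show ?case by (simp add: mult.assoc der_cst) (simp add: algebra_simps)
qed (simp_all add: distrib_left distrib_right der_add algebra_simps)

text \<open>The commutator of two derivations is a derivation, so it is determined by the generators.\<close>
lemma der_commutator:
  "der \<phi> (der \<psi> g) - der \<psi> (der \<phi> g) = der (\<lambda>n. der \<phi> (\<psi> n) - der \<psi> (\<phi> n)) g"
proof (induction rule: fock_induct[where g = g])
  case (mon M)
  show ?case
  proof (induction M)
    case (add n M)
    then show ?case by (simp add: mult.assoc mon_add_mset der_var_mult der_mult der_add) (simp add: algebra_simps)
  qed simp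
next
  case (cst c h)
  then show ?case by (simp add: der_cst) (metis right_diff_distrib)
next
  case (add h h')
  then show ?case by (simp add: der_add algebra_simps)
qed simp

text \<open>\<open>Q k d f\<close> is the action of \<open>\<Sum>\<^sub>j f(-j) \<alpha>(j) \<alpha>(-d-j)\<close> on the charge one sector
  \<open>M(1) \<otimes> e\<^sup>\<alpha> = \<complex>[x\<^sub>1, x\<^sub>2, \<dots>]\<close>, where \<open>\<alpha>(-n)\<close> is multiplication by \<open>x\<^sub>n\<close>,
  \<open>\<alpha>(n) = 2kn \<partial>/\<partial>x\<^sub>n\<close> and \<open>\<alpha>(0) = 2k\<close>.  The factors commute because \<open>d \<noteq> 0\<close>,
  and the operator is of first order because \<open>d > 0\<close>.\<close>
definition Qpol :: "nat \<Rightarrow> nat \<Rightarrow> (int \<Rightarrow> complex) \<Rightarrow> fock" where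
  "Qpol k d f = (\<Sum>a=1..<d. cst (f (int a)) * (var a * var (d - a)))
     + cst (2 * of_nat k * (f 0 + f (int d))) * var d"

definition Qder :: "nat \<Rightarrow> nat \<Rightarrow> (int \<Rightarrow> complex) \<Rightarrow> nat \<Rightarrow> fock" where
  "Qder k d f n = cst (2 * of_nat k * of_nat n * (f (- int n) + f (int d + int n))) * var (d + n)"

definition Q :: "nat \<Rightarrow> nat \<Rightarrow> (int \<Rightarrow> complex) \<Rightarrow> fock \<Rightarrow> fock" where
  "Q k d f g = Qpol k d f * g + der (Qder k d f) g"

lemma Q_add: "Q k d f (g + h) = Q k d f g + Q k d f h"
  by (simp add: Q_def der_add algebra_simps)

lemma Q_cst: "Q k d f (cst c * g) = cst c * Q k d f g"
  by (simp add: Q_def der_cst distrib_left mult.left_commute)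

text \<open>A derivation depends linearly on its values on the generators; this makes
  \<open>Q\<close> linear in the weight \<open>f\<close>.\<close>

lemma der_fun_lin: "der (\<lambda>n. cst c * \<phi> n + \<psi> n) g = cst c * der \<phi> g + der \<psi> g"
proof (induction rule: fock_induct[where g = g])
  case (mon M)
  show ?case
  proof (induction M)
    case (add n M)
    then show ?case by (simp add: mult.assoc mon_add_mset der_var_mult) (simp add: algebra_simps)
  qed simp
next
  case (cst c h)
  then show ?case by (simp add: mult.assoc der_cst) (simp add: algebra_simps)
next
  case (add h h')
  then show ?case by (simp add: der_add algebra_simps)
qed simp

lemma Q_fun_lin: "Q k d (\<lambda>a. c * f a + h a) g = cst c * Q k d f g + Q k d h g"
proof -
  have 1: "Qpol k d (\<lambda>a. c * f a + h a) = cst c * Qpol k d f + Qpol k d h"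
    by (simp add: Qpol_def sum_distrib_left cst_add cst_mult algebra_simps sum.distrib)
  have 2: "Qder k d (\<lambda>a. c * f a + h a) = (\<lambda>n. cst c * Qder k d f n + Qder k d h n)"
    by (rule ext) (simp add: Qder_def cst_add cst_mult algebra_simps)
  show ?thesis by (simp only: Q_def 1 2 der_fun_lin) (simp add: algebra_simps)
qed

section \<open>The Virasoro operators L(-1) and L(-2) and their commutators\<close>

definition vir1 :: "nat \<Rightarrow> fock \<Rightarrow> fock" where
  "vir1 k = Q k 1 (\<lambda>_. 1 / of_nat (4 * k))"

text \<open>The modes of \<omega> carry the constant weight 1/(4k), since both factors of
  alpha(-1)^2 enter undifferentiated. Degree 1 gives L(-1), degree 2 gives L(-2).\<close>

definition vir2 :: "nat \<Rightarrow> fock \<Rightarrow> fock" where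
  "vir2 k = Q k 2 (\<lambda>_. 1 / of_nat (4 * k))"

lemma vir1_eq:
  assumes "k > 0"
  shows "vir1 k g = var 1 * g + der (\<lambda>n. cst (of_nat n) * var (Suc n)) g"
proof -
  have "Qpol k 1 (\<lambda>_. 1 / of_nat (4 * k)) = var 1"
    using assms by (simp add: Qpol_def)
  moreover have "Qder k 1 (\<lambda>_. 1 / of_nat (4 * k)) = (\<lambda>n. cst (of_nat n) * var (Suc n))"
    using assms by (simp add: Qder_def fun_eq_iff)
  ultimately show ?thesis by (simp add: vir1_def Q_def)
qed

lemma vir2_eq:
  assumes "k > 0"
  shows "vir2 k g = (var 2 + cst (1 / of_nat (4 * k)) * (var 1 * var 1)) * g
    + der (\<lambda>n. cst (of_nat n) * var (n + 2)) g"
proof -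
  have "Qpol k 2 (\<lambda>_. 1 / of_nat (4 * k)) = var 2 + cst (1 / of_nat (4 * k)) * (var 1 * var 1)"
    using assms by (simp add: Qpol_def numeral_2_eq_2)
  moreover have "Qder k 2 (\<lambda>_. 1 / of_nat (4 * k)) = (\<lambda>n. cst (of_nat n) * var (n + 2))"
    using assms by (simp add: Qder_def fun_eq_iff)
  ultimately show ?thesis by (simp add: vir2_def Q_def)
qed

text \<open>The multiplication part of [L(-2), Q]. If the two operators are p + D and P + delta,
  with multiplications p, P and derivations D, delta, this part is D(P) - delta(p). The new weight
  comes from [L(-2), alpha(-a)] = a alpha(-a-2), applied to each of the two factors.\<close>

lemma Qpol_raise:
  fixes f :: "int \<Rightarrow> complex"
  assumes k: "k > 0" and d: "d \<ge> 1"
  defines "g \<equiv> \<lambda>a. of_int (a - 2) * f (a - 2) + of_int (int d - a) * f a"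
  shows "der (\<lambda>n. cst (of_nat n) * var (n + 2)) (Qpol k d f)
       - der (Qder k d f) (var 2 + cst (1 / of_nat (4 * k)) * (var 1 * var 1)) = Qpol k (d + 2) g"
proof -
  define x where "x a b = var a * var b" for a b
  \<comment> \<open>The term a = 2 has coefficient zero and a = 1 gives a boundary term; the
    remaining terms are shifted by two.\<close>
  have L: "(\<Sum>a=1..<d+2. cst (of_int (int a - 2) * f (int a - 2)) * x a (d + 2 - a))
     = - cst (f (-1)) * x 1 (d + 1) + (\<Sum>a=1..<d. cst (of_nat a * f (int a)) * x (a + 2) (d - a))"
  proof -
    have "(\<Sum>a=1..<d+2. cst (of_int (int a - 2) * f (int a - 2)) * x a (d + 2 - a))
      = - cst (f (-1)) * x 1 (d + 1) + (\<Sum>a=3..<d+2. cst (of_int (int a - 2) * f (int a - 2)) * x a (d + 2 - a))"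
      using d sum.atLeast_Suc_lessThan[of 1 "d + 2" "\<lambda>a. cst (of_int (int a - 2) * f (int a - 2)) * x a (d + 2 - a)"]
        sum.atLeast_Suc_lessThan[of 2 "d + 2" "\<lambda>a. cst (of_int (int a - 2) * f (int a - 2)) * x a (d + 2 - a)"]
      by (simp add: cst_uminus flip: numeral_2_eq_2 numeral_3_eq_3)
    also have "(\<Sum>a=3..<d+2. cst (of_int (int a - 2) * f (int a - 2)) * x a (d + 2 - a))
      = (\<Sum>a=1..<d. cst (of_nat a * f (int a)) * x (a + 2) (d - a))"
      by (rule sum.reindex_bij_witness[of _ "\<lambda>a. a + 2" "\<lambda>a. a - 2"])
        (auto simp: of_nat_diff Suc_diff_Suc numeral_2_eq_2)
    finally show ?thesis .
  qed
  \<comment> \<open>Here a = d drops out and a = d + 1 gives the other boundary term.\<close>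
  have R: "(\<Sum>a=1..<d+2. cst (of_int (int d - int a) * f (int a)) * x a (d + 2 - a))
     = - cst (f (int d + 1)) * x (d + 1) 1 + (\<Sum>a=1..<d. cst (of_nat (d - a) * f (int a)) * x a (d - a + 2))"
  proof -
    have "(\<Sum>a=1..<d+2. cst (of_int (int d - int a) * f (int a)) * x a (d + 2 - a))
      = (\<Sum>a=1..<d. cst (of_int (int d - int a) * f (int a)) * x a (d + 2 - a)) - cst (f (int d + 1)) * x (d + 1) 1"
      using d by (simp add: cst_uminus algebra_simps)
    also have "(\<Sum>a=1..<d. cst (of_int (int d - int a) * f (int a)) * x a (d + 2 - a))
       = (\<Sum>a=1..<d. cst (of_nat (d - a) * f (int a)) * x a (d - a + 2))"
      by (rule sum.cong) (auto simp: of_nat_diff Suc_diff_le)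
    finally show ?thesis by simp
  qed
  have "Qpol k (d + 2) g = (\<Sum>a=1..<d+2. cst (of_int (int a - 2) * f (int a - 2)) * x a (d + 2 - a))
      + (\<Sum>a=1..<d+2. cst (of_int (int d - int a) * f (int a)) * x a (d + 2 - a))
      + cst (2 * of_nat k * (g 0 + g (int (d + 2)))) * var (d + 2)"
    by (simp only: Qpol_def g_def x_def cst_add distrib_right sum.distrib)
  also have "\<dots> = - cst (f (-1)) * x 1 (d + 1) - cst (f (int d + 1)) * x (d + 1) 1
      + (\<Sum>a=1..<d. cst (f (int a)) * (cst (of_nat a) * x (a + 2) (d - a) + cst (of_nat (d - a)) * x a (d - a + 2)))
      + cst (2 * of_nat k * (g 0 + g (int (d + 2)))) * var (d + 2)"
    unfolding L R by (simp only: cst_mult distrib_left sum.distrib) (simp add: ac_simps)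
  also have "g 0 + g (int (d + 2)) = of_nat d * (f 0 + f (int d)) - 2 * (f (-2) + f (int d + 2))"
    by (simp add: g_def algebra_simps)
  finally have *: "Qpol k (d + 2) g = - cst (f (-1)) * x 1 (d + 1) - cst (f (int d + 1)) * x (d + 1) 1
      + (\<Sum>a=1..<d. cst (f (int a)) * (cst (of_nat a) * x (a + 2) (d - a) + cst (of_nat (d - a)) * x a (d - a + 2)))
      + cst (2 * of_nat k * (of_nat d * (f 0 + f (int d)) - 2 * (f (-2) + f (int d + 2)))) * var (d + 2)" .
  have **: "cst (1 / (4 * of_nat k)) * (cst (2 * of_nat k * z) * y) = cst (z / 2) * y" for z y
    using k by (simp flip: cst_mult mult.assoc)
  have ***: "y + y = cst 2 * y" for y
    using cst_add[of 1 1] by (simp add: algebra_simps)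
  \<comment> \<open>The factor 1/(4k) cancels against 2k and the two equal summands. What is left
    matches the two boundary terms.\<close>
  have 1: "der (Qder k d f) (cst (1 / of_nat (4 * k)) * (var 1 * var 1))
     = cst (f (-1)) * x 1 (d + 1) + cst (f (int d + 1)) * x (d + 1) 1"
  proof -
    have "der (Qder k d f) (cst (1 / of_nat (4 * k)) * (var 1 * var 1))
      = cst (1 / (4 * of_nat k)) * (cst (2 * of_nat k * (f (-1) + f (int d + 1))) * (x 1 (d+1) + x 1 (d+1)))"
      by (simp add: der_cst der_mult Qder_def x_def)
    also have "\<dots> = cst (f (-1) + f (int d + 1)) * x 1 (d + 1)"
      unfolding ** *** by (simp add: add_divide_distrib flip: cst_mult mult.assoc)
    finally show ?thesis by (simp add: cst_add x_def algebra_simps)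
  qed
  have 2: "der (Qder k d f) (var 2) = cst (2 * of_nat k * (2 * (f (-2) + f (int d + 2)))) * var (d + 2)"
    by (simp add: Qder_def algebra_simps)
  have 3: "der (\<lambda>n. cst (of_nat n) * var (n + 2)) (Qpol k d f)
    = (\<Sum>a=1..<d. cst (f (int a)) * (cst (of_nat a) * x (a + 2) (d - a) + cst (of_nat (d - a)) * x a (d - a + 2)))
     + cst (2 * of_nat k * (of_nat d * (f 0 + f (int d)))) * var (d + 2)"
    by (simp add: Qpol_def der_add der_sum der_cst der_mult x_def cst_mult)
      (simp add: cst_mult cst_add algebra_simps)
  show ?thesis
    unfolding * der_add 1 2 3 by (simp add: cst_diff algebra_simps)
qed

text \<open>Both operators are a multiplication plus a derivation, so it is enough to compare the
  multiplication parts and, by \<open>der_commutator\<close>, the values of the derivations on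
  generators.\<close>

lemma vir2_Q_commutator:
  fixes f :: "int \<Rightarrow> complex"
  assumes k: "k > 0" and d: "d \<ge> 1"
  shows "vir2 k (Q k d f h) - Q k d f (vir2 k h)
    = Q k (d + 2) (\<lambda>a. of_int (a - 2) * f (a - 2) + of_int (int d - a) * f a) h"
    (is "_ = Q k (d + 2) ?g h")
proof -
  let ?e = "\<lambda>n. cst (of_nat n) * var (n + 2)"
  let ?p = "var 2 + cst (1 / of_nat (4 * k)) * (var 1 * var 1)"
  have "der ?e (Qder k d f n) - der (Qder k d f) (?e n) = Qder k (d + 2) ?g n" for n
  proof -
    have "f (- 2 - int n) = f (- int n - 2)" by (rule arg_cong[of _ _ f]) simp
    then show ?thesis
      by (simp add: Qder_def der_cst) (simp add: cst_mult cst_add cst_diff algebra_simps)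
  qed
  then have "der ?e (der (Qder k d f) h) - der (Qder k d f) (der ?e h) = der (Qder k (d + 2) ?g) h"
    by (simp add: der_commutator)
  then show ?thesis
    using Qpol_raise[OF assms, of f]
    by (simp add: Q_def vir2_eq[OF k] der_add der_mult algebra_simps)
qed

section \<open>Reduction to the descendants of the highest weight vector\<close>

text \<open>With j = -a, this is the coefficient of alpha(j) alpha(-d-j) in the mode of
  alpha(-r-1)alpha(-s-1)1 that raises the degree by d. Generalized binomials occur because a and d -
  a range over all integers.\<close>

definition bin :: "nat \<Rightarrow> nat \<Rightarrow> nat \<Rightarrow> int \<Rightarrow> complex" where
  "bin r s d a = (of_int (a - 1) gchoose r) * (of_int (int d - a - 1) gchoose s)"

section \<open>Positivity of the indices and the reduction space\<close>

definition posm :: "nat multiset \<Rightarrow> bool" where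
  "posm M \<longleftrightarrow> (\<forall>n\<in>#M. 0 < n)"

definition posf :: "fock \<Rightarrow> bool" where
  "posf g \<longleftrightarrow> (\<forall>M\<in>keys g. posm M)"

lemma posm_add_mset [simp]: "posm (add_mset n M) \<longleftrightarrow> 0 < n \<and> posm M"
  by (simp add: posm_def)

lemma posm_empty [simp]: "posm {#}"
  by (simp add: posm_def)

lemma posm_plus: "posm (M + N) \<longleftrightarrow> posm M \<and> posm N"
  by (auto simp: posm_def)

lemma posm_diff: "posm M \<Longrightarrow> posm (M - N)"
  by (auto simp: posm_def dest: in_diffD)

lemma posf_0 [simp]: "posf 0"
  by (simp add: posf_def)

lemma posf_add: "posf g \<Longrightarrow> posf h \<Longrightarrow> posf (g + h)"
  using keys_add[of g h] by (auto simp: posf_def)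

lemma posf_mult: "posf g \<Longrightarrow> posf h \<Longrightarrow> posf (g * h)"
  using keys_mult[of g h] by (auto simp: posf_def posm_plus)

lemma posf_cst [simp]: "posf (cst c)"
  by (simp add: posf_def cst_def)

lemma posf_mon [simp]: "posf (mon M) \<longleftrightarrow> posm M"
  by (simp add: posf_def mon_def)

lemma posf_var [simp]: "posf (var n) \<longleftrightarrow> 0 < n"
  by (simp add: var_def)

lemma posf_sum: "(\<And>i. i \<in> I \<Longrightarrow> posf (g i)) \<Longrightarrow> posf (\<Sum>i\<in>I. g i)"
  by (induction I rule: infinite_finite_induct) (auto intro: posf_add)

lemma posf_sum_mset: "(\<And>i. i \<in># I \<Longrightarrow> posf (g i)) \<Longrightarrow> posf (\<Sum>i\<in>#I. g i)"
  by (induction I) (auto intro: posf_add)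

lemma posf_der:
  assumes "posf g" "\<And>n. 0 < n \<Longrightarrow> posf (\<phi> n)"
  shows "posf (der \<phi> g)"
proof (induction rule: fock_induct[where g = g])
  case (mon M)
  with assms(1) have "posm M" by (simp add: posf_def)
  then show ?case
    using assms(2) by (auto simp: der_mon posm_def[of M] intro!: posf_sum_mset posf_mult posm_diff)
qed (auto simp: der_cst der_add intro: posf_add posf_mult)

lemma posf_Q:
  assumes "posf g" "d \<ge> 1"
  shows "posf (Q k d f g)"
  unfolding Q_def Qpol_def
  using assms by (auto simp: Qder_def intro!: posf_add posf_mult posf_sum posf_der)

lemma posf_vir2: "posf g \<Longrightarrow> posf (vir2 k g)"
  by (simp add: vir2_def posf_Q)

text \<open>Combinations of Virasoro descendants \<open>L(-2)\<^sup>s e\<^sup>\<alpha>\<close> and of the elements \<open>L(-1)h\<close> and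
  \<open>(\<alpha>(-r-1)\<alpha>(-s-1)\<one>)\<^sub>-\<^sub>2 h\<close> of \<open>C\<^sub>2\<close>.\<close>
inductive_set red :: "nat \<Rightarrow> fock set" for k :: nat where
  red_0: "0 \<in> red k"
| red_add: "g \<in> red k \<Longrightarrow> h \<in> red k \<Longrightarrow> g + h \<in> red k"
| red_cst: "g \<in> red k \<Longrightarrow> cst c * g \<in> red k"
| red_vac: "(vir2 k ^^ s) 1 \<in> red k"
| red_vir1: "posf h \<Longrightarrow> vir1 k h \<in> red k"
| red_Q: "posf h \<Longrightarrow> Q k (r + s + 3) (bin r s (r + s + 3)) h \<in> red k"

section \<open>Stability of the reduction space under L(-2)\<close>

lemma red_uminus: "g \<in> red k \<Longrightarrow> - g \<in> red k"
  using red_cst[of g k "-1"] by (simp add: cst_uminus)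

lemma red_diff: "g \<in> red k \<Longrightarrow> h \<in> red k \<Longrightarrow> g - h \<in> red k"
  using red_add[of g k "- h"] red_uminus[of h k] by simp

lemma red_sum_mset: "(\<And>i. i \<in># I \<Longrightarrow> g i \<in> red k) \<Longrightarrow> (\<Sum>i\<in>#I. g i) \<in> red k"
  by (induction I) (auto intro: red_0 red_add)

lemma Q_fun_comb: "Q k d (\<lambda>a. c * f a + e * h a) g = cst c * Q k d f g + cst e * Q k d h g"
proof -
  have "Q k d (\<lambda>_. 0) g = 0"
    by (simp add: Q_def Qpol_def Qder_def der_def linext_def)
  then show ?thesis
    using Q_fun_lin[of k d c f "\<lambda>a. e * h a" g] Q_fun_lin[of k d e h "\<lambda>_. 0" g] by simp
qed

text \<open>With x = a - 1 and y = d - a - 1 the factor on the left is (x - r) + (y - s), and (x -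
  r) binom(x, r) = (r + 1) binom(x, r + 1). In terms of modes this is (L(-1)u)_n = -n u_(n-1) for u
  = alpha(-r-1)alpha(-s-1)1.\<close>

lemma bin_raise:
  "(of_int (int d) - of_nat r - of_nat s - 2) * bin r s d a
    = of_nat (Suc r) * bin (Suc r) s d a + of_nat (Suc s) * bin r (Suc s) d a"
proof -
  define x y where "x = (of_int (a - 1) :: complex)" and "y = (of_int (int d - a - 1) :: complex)"
  have "of_int (int d) = x + y + 2" by (simp add: x_def y_def)
  then have "(of_int (int d) - of_nat r - of_nat s - 2) * bin r s d a
     = (x * (x gchoose r) - of_nat r * (x gchoose r)) * (y gchoose s)
      + (x gchoose r) * (y * (y gchoose s) - of_nat s * (y gchoose s))"
    unfolding bin_def x_def[symmetric] y_def[symmetric] by (simp add: algebra_simps)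
  also have "\<dots> = (of_nat (Suc r) * (x gchoose Suc r)) * (y gchoose s) + (x gchoose r) * (of_nat (Suc s) * (y gchoose Suc s))"
    by (simp only: gbinomial_mult_1 add_diff_cancel_left')
  finally show ?thesis
    unfolding bin_def x_def[symmetric] y_def[symmetric] by (simp add: algebra_simps)
qed

text \<open>Covers all modes u_(-2-e) of quadratic vectors u: for fixed \<open>d\<close> the
  identity \<open>bin_raise\<close> trades one unit of \<open>e\<close> for one unit of
  \<open>r\<close> or \<open>s\<close>, until e = 0 and \<open>red_Q\<close> applies.\<close>

lemma red_bin:
  assumes "posf h" "d = r + s + 3 + e"
  shows "Q k d (bin r s d) h \<in> red k"
  using assms(2)
proof (induction e arbitrary: r s)
  case 0
  then show ?case using red_Q[OF assms(1)] by simp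
next
  case (Suc e)
  \<comment> \<open>The step is at \<open>Suc e\<close>, so d - r - s - 2 is e + 2, which is
    invertible.\<close>
  define c where "c = (of_nat e + 2 :: complex)"
  have c0: "c \<noteq> 0" unfolding c_def by (metis of_nat_0_neq of_nat_Suc add_Suc_right of_nat_add one_add_one of_nat_1 add.assoc)
  have eq: "of_int (int d) - of_nat r - of_nat s - 2 = c" using Suc.prems by (simp add: c_def)
  have "bin r s d = (\<lambda>a. (of_nat (Suc r) / c) * bin (Suc r) s d a + (of_nat (Suc s) / c) * bin r (Suc s) d a)"
    using bin_raise[of d r s] c0 unfolding eq by (auto simp: fun_eq_iff field_simps)
  moreover have "Q k d (bin (Suc r) s d) h \<in> red k" "Q k d (bin r (Suc s) d) h \<in> red k"
    by (rule Suc.IH, simp add: Suc.prems)+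
  ultimately show ?case
    using Q_fun_comb[of k d "of_nat (Suc r) / c" "bin (Suc r) s d" "of_nat (Suc s) / c" "bin r (Suc s) d" h]
    by (auto intro!: red_add red_cst)
qed

lemma gbinomial_Pascal_shift: "(x - 1 gchoose Suc r) = (x gchoose Suc r) - (x - 1 gchoose r)"
  for x :: complex
  using gbinomial_addition_formula[of x r] by simp

text \<open>Commuting with L(-2) lowers the upper argument of one binomial by one. Pascal's rule
  undoes this shift at the cost of a term with smaller \<open>r\<close>, for which the bound on
  \<open>d\<close> still holds.\<close>

lemma red_bin_shift_left:
  assumes "posf h" "r + s + 3 \<le> d"
  shows "Q k d (\<lambda>a. (of_int (a - 2) gchoose r) * (of_int (int d - a - 1) gchoose s)) h \<in> red k"
  using assms(2)
proof (induction r)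
  case 0
  have "(\<lambda>a. (of_int (a - 2) gchoose 0) * (of_int (int d - a - 1) gchoose s)) = bin 0 s d"
    by (simp add: bin_def fun_eq_iff)
  then show ?case using red_bin[OF assms(1), of d 0 s "d - (s + 3)" k] 0 by simp
next
  case (Suc r)
  have "(\<lambda>a. (of_int (a - 2) gchoose Suc r) * (of_int (int d - a - 1) gchoose s))
    = (\<lambda>a. 1 * bin (Suc r) s d a + (- 1) * ((of_int (a - 2) gchoose r) * (of_int (int d - a - 1) gchoose s)))"
  proof
    fix a
    have "of_int (a - 2) = (of_int (a - 1) - 1 :: complex)" by simp
    then show "(of_int (a - 2) gchoose Suc r) * (of_int (int d - a - 1) gchoose s)
      = 1 * bin (Suc r) s d a + (- 1) * ((of_int (a - 2) gchoose r) * (of_int (int d - a - 1) gchoose s))"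
      by (simp only: bin_def gbinomial_Pascal_shift) (simp add: left_diff_distrib)
  qed
  moreover have "Q k d (bin (Suc r) s d) h \<in> red k"
    using Suc.prems by (intro red_bin[OF assms(1), of _ _ _ "d - (Suc r + s + 3)"]) simp
  moreover have "Q k d (\<lambda>a. (of_int (a - 2) gchoose r) * (of_int (int d - a - 1) gchoose s)) h \<in> red k"
    using Suc by simp
  ultimately show ?case by (simp only: Q_fun_comb red_add red_cst)
qed

lemma red_bin_shift_right:
  assumes "posf h" "r + s + 3 \<le> d"
  shows "Q k d (\<lambda>a. (of_int (a - 1) gchoose r) * (of_int (int d - a - 2) gchoose s)) h \<in> red k"
  using assms(2)
proof (induction s)
  case 0
  have "(\<lambda>a. (of_int (a - 1) gchoose r) * (of_int (int d - a - 2) gchoose 0)) = bin r 0 d"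
    by (simp add: bin_def fun_eq_iff)
  then show ?case using red_bin[OF assms(1), of d r 0 "d - (r + 3)" k] 0 by simp
next
  case (Suc s)
  have "(\<lambda>a. (of_int (a - 1) gchoose r) * (of_int (int d - a - 2) gchoose Suc s))
    = (\<lambda>a. 1 * bin r (Suc s) d a + (- 1) * ((of_int (a - 1) gchoose r) * (of_int (int d - a - 2) gchoose s)))"
  proof
    fix a
    have "of_int (int d - a - 2) = (of_int (int d - a - 1) - 1 :: complex)" by simp
    then show "(of_int (a - 1) gchoose r) * (of_int (int d - a - 2) gchoose Suc s)
      = 1 * bin r (Suc s) d a + (- 1) * ((of_int (a - 1) gchoose r) * (of_int (int d - a - 2) gchoose s))"
      by (simp only: bin_def gbinomial_Pascal_shift) (simp add: right_diff_distrib)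
  qed
  moreover have "Q k d (bin r (Suc s) d) h \<in> red k"
    using Suc.prems by (intro red_bin[OF assms(1), of _ _ _ "d - (r + Suc s + 3)"]) simp
  moreover have "Q k d (\<lambda>a. (of_int (a - 1) gchoose r) * (of_int (int d - a - 2) gchoose s)) h \<in> red k"
    using Suc by simp
  ultimately show ?case by (simp only: Q_fun_comb red_add red_cst)
qed

lemma gbinomial_absorb_shift: "x * (x - 1 gchoose r) = of_nat (Suc r) * (x gchoose Suc r)"
  for x :: complex
  using Suc_times_gbinomial[of r "x - 1"] by simp

text \<open>L(-2) commutes with L(-1) and with the quadratic modes up to quadratic modes of larger
  degree, and these lie in \<open>red\<close> again.\<close>

lemma red_vir2:
  assumes "k > 0" "g \<in> red k"
  shows "vir2 k g \<in> red k"
  using assms(2)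
proof induction
  case (red_vac s)
  show ?case using red.red_vac[of "Suc s" k] by simp
next
  case (red_vir1 h)
  let ?c = "1 / of_nat (4 * k) :: complex"
  \<comment> \<open>This is [L(-2), L(-1)] = -L(-3); the zero summand brings it to the form of
    \<open>Q_fun_comb\<close>.\<close>
  have "vir2 k (vir1 k h) = vir1 k (vir2 k h) + Q k 3 (\<lambda>a. (- ?c) * bin 0 0 3 a + 0 * bin 0 0 3 a) h"
    using vir2_Q_commutator[OF assms(1), of 1 "\<lambda>_. ?c" h]
    by (simp add: vir1_def bin_def numeral_3_eq_3 left_diff_distrib[symmetric] add_divide_distrib[symmetric]
        diff_divide_distrib[symmetric] algebra_simps)
  then show ?case
    using red_bin[OF red_vir1, of 3 0 0 0 k] red.red_vir1[OF posf_vir2[OF red_vir1]]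
    unfolding Q_fun_comb by (auto intro!: red.intros(2,3))
next
  case (red_Q h r s)
  define d where "d = r + s + 3"
  have "vir2 k (Q k d (bin r s d) h) - Q k d (bin r s d) (vir2 k h)
    = Q k (d + 2) (\<lambda>a. of_int (a - 2) * bin r s d (a - 2) + of_int (int d - a) * bin r s d a) h"
    using assms(1) by (intro vir2_Q_commutator) (simp_all add: d_def)
  \<comment> \<open>The factors a - 2 and d - a are absorbed into the binomials. This raises
    \<open>r\<close> or \<open>s\<close> by one and, relative to degree d + 2, leaves one upper
    argument shifted by one.\<close>
  also have "(\<lambda>a. of_int (a - 2) * bin r s d (a - 2) + of_int (int d - a) * bin r s d a)
    = (\<lambda>a. of_nat (Suc r) * ((of_int (a - 2) gchoose Suc r) * (of_int (int (d + 2) - a - 1) gchoose s))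
      + of_nat (Suc s) * ((of_int (a - 1) gchoose r) * (of_int (int (d + 2) - a - 2) gchoose Suc s)))"
  proof
    fix a
    have "of_int (a - 2) * bin r s d (a - 2)
      = (of_int (a - 2) * (of_int (a - 2) - 1 gchoose r)) * (of_int (int (d + 2) - a - 1) gchoose s)"
      by (simp add: bin_def algebra_simps)
    moreover have "of_int (int d - a) * bin r s d a
      = (of_int (a - 1) gchoose r) * (of_int (int d - a) * (of_int (int d - a) - 1 gchoose s))"
      by (simp add: bin_def algebra_simps)
    ultimately show "of_int (a - 2) * bin r s d (a - 2) + of_int (int d - a) * bin r s d a
      = of_nat (Suc r) * ((of_int (a - 2) gchoose Suc r) * (of_int (int (d + 2) - a - 1) gchoose s))
      + of_nat (Suc s) * ((of_int (a - 1) gchoose r) * (of_int (int (d + 2) - a - 2) gchoose Suc s))"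
      unfolding gbinomial_absorb_shift by (simp only: ac_simps) (simp add: algebra_simps)
  qed
  finally have "vir2 k (Q k d (bin r s d) h) = Q k d (bin r s d) (vir2 k h)
    + (cst (of_nat (Suc r)) * Q k (d + 2) (\<lambda>a. (of_int (a - 2) gchoose Suc r) * (of_int (int (d + 2) - a - 1) gchoose s)) h
     + cst (of_nat (Suc s)) * Q k (d + 2) (\<lambda>a. (of_int (a - 1) gchoose r) * (of_int (int (d + 2) - a - 2) gchoose Suc s)) h)"
    unfolding Q_fun_comb by (simp only: diff_eq_eq add.commute)
  moreover have "Q k d (bin r s d) (vir2 k h) \<in> red k"
    unfolding d_def by (intro red.red_Q posf_vir2 red_Q)
  moreover have "Q k (d + 2) (\<lambda>a. (of_int (a - 2) gchoose Suc r) * (of_int (int (d + 2) - a - 1) gchoose s)) h \<in> red k"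
    by (intro red_bin_shift_left red_Q) (simp add: d_def)
  moreover have "Q k (d + 2) (\<lambda>a. (of_int (a - 1) gchoose r) * (of_int (int (d + 2) - a - 2) gchoose Suc s)) h \<in> red k"
    by (intro red_bin_shift_right red_Q) (simp add: d_def)
  ultimately show ?case unfolding d_def[symmetric] by (simp only: red.red_add red.red_cst)
qed (simp_all add: vir2_def Q_add Q_cst red.intros(2,3) red_0, simp add: Q_def red_0)

section \<open>Reduction by the length of a monomial\<close>

lemma Qpol_bin:
  "Qpol k (r + s + 3) (bin r s (r + s + 3))
    = cst (of_nat (Suc s)) * (var (Suc r) * var (s + 2)) + cst (of_nat (Suc r)) * (var (r + 2) * var (Suc s))
      + cst (2 * of_nat k * (bin r s (r + s + 3) 0 + bin r s (r + s + 3) (int (r + s + 3)))) * var (r + s + 3)"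
proof -
  define d where "d = r + s + 3"
  have b: "bin r s d (int a) = of_nat ((a - 1) choose r) * of_nat ((d - a - 1) choose s)"
    if "1 \<le> a" "a < d" for a
  proof -
    have "of_int (int a - 1) = (of_nat (a - 1) :: complex)"
      "of_int (int d - int a - 1) = (of_nat (d - a - 1) :: complex)"
      using that by (auto simp: of_nat_diff)
    then show ?thesis by (simp only: bin_def binomial_gbinomial)
  qed
  \<comment> \<open>These binomials are ordinary ones whose upper entries a - 1 and d - a - 1 add up
    to r + s + 1, so both are nonzero only for a = r + 1 and a = r + 2.\<close>
  have "(\<Sum>a=1..<d. cst (bin r s d (int a)) * (var a * var (d - a)))
    = (\<Sum>a\<in>{Suc r, Suc (Suc r)}. cst (bin r s d (int a)) * (var a * var (d - a)))"
  proof (rule sum.mono_neutral_right)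
    show "\<forall>a\<in>{1..<d} - {Suc r, Suc (Suc r)}. cst (bin r s d (int a)) * (var a * var (d - a)) = 0"
    proof
      fix a assume a: "a \<in> {1..<d} - {Suc r, Suc (Suc r)}"
      then have "a - 1 < r \<or> d - a - 1 < s" by (auto simp: d_def)
      then show "cst (bin r s d (int a)) * (var a * var (d - a)) = 0"
        using a b[of a] by (auto simp: binomial_eq_0)
    qed
  qed (auto simp: d_def)
  also have "\<dots> = cst (of_nat (Suc s)) * (var (Suc r) * var (s + 2)) + cst (of_nat (Suc r)) * (var (r + 2) * var (Suc s))"
  proof -
    have "bin r s d (int (Suc r)) = of_nat (Suc s)"
      by (subst b) (auto simp: d_def)
    moreover have "bin r s d (int (Suc (Suc r))) = of_nat (Suc r)"
      by (subst b) (auto simp: d_def)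
    moreover have "d - Suc r = s + 2" "d - Suc (Suc r) = Suc s" by (auto simp: d_def)
    ultimately show ?thesis by simp
  qed
  finally show ?thesis by (simp only: Qpol_def d_def)
qed

text \<open>A quadratic mode moves one unit of degree from one variable to another modulo shorter
  monomials. Once the second variable has become x_1, the relation L(-1)h replaces x_1 h by -D h,
  whose monomials are shorter by one.\<close>

lemma red_length_step:
  assumes k: "k > 0"
    and IH: "\<And>N. size N < size M + 2 \<Longrightarrow> posm N \<Longrightarrow> mon N \<in> red k"
    and M: "posm M" and a: "0 < a"
  shows "mon (add_mset a (add_mset (Suc b) M)) \<in> red k"
  using a
proof (induction b arbitrary: a)
  case 0
  let ?N = "add_mset a M"
  have N: "posm ?N" using M 0 by simp
  have "der (\<lambda>n. cst (of_nat n) * var (Suc n)) (mon ?N)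
    = (\<Sum>n\<in>#?N. cst (of_nat n) * mon (add_mset (Suc n) (?N - {#n#})))"
    by (simp only: der_mon) (simp only: mon_add_mset mult.assoc)
  also have "\<dots> \<in> red k"
  proof (intro red_sum_mset red_cst IH)
    fix n assume "n \<in># ?N"
    then show "size (add_mset (Suc n) (?N - {#n#})) < size M + 2"
      using size_Suc_Diff1[of n ?N] by simp
    show "posm (add_mset (Suc n) (?N - {#n#}))"
      using posm_diff[OF N] by simp
  qed
  finally have "vir1 k (mon ?N) - der (\<lambda>n. cst (of_nat n) * var (Suc n)) (mon ?N) \<in> red k"
    using N by (intro red_diff red_vir1) simp_all
  then show ?case
    using k by (simp add: vir1_eq mon_add_mset ac_simps)
next
  case (Suc s)
  obtain r where r: "a = Suc r" using Suc.prems by (cases a) auto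
  define d where "d = r + s + 3"
  define f where "f = bin r s d"
  have "der (Qder k d f) (mon M)
    = (\<Sum>n\<in>#M. cst (2 * of_nat k * of_nat n * (f (- int n) + f (int d + int n))) * mon (add_mset (d + n) (M - {#n#})))"
    unfolding der_mon mon_add_mset by (simp only: mult.assoc Qder_def)
  also have "\<dots> \<in> red k"
  proof (intro red_sum_mset red_cst IH)
    fix n assume "n \<in># M"
    then show "size (add_mset (d + n) (M - {#n#})) < size M + 2"
      using size_Suc_Diff1[of n M] by simp
    show "posm (add_mset (d + n) (M - {#n#}))"
      using posm_diff[OF M] by (simp add: d_def)
  qed
  finally have 1: "der (Qder k d f) (mon M) \<in> red k" .
  have 2: "mon (add_mset d M) \<in> red k"
    using M by (intro IH) (auto simp: d_def)
  have 3: "Q k d f (mon M) \<in> red k"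
    unfolding d_def f_def using M by (intro red_Q) simp
  have 4: "mon (add_mset (Suc a) (add_mset (Suc s) M)) \<in> red k"
    by (rule Suc.IH) simp
  define c where "c = 2 * of_nat k * (f 0 + f (int d))"
  have "Q k d f (mon M) = cst (of_nat (Suc s)) * mon (add_mset a (add_mset (Suc (Suc s)) M))
     + cst (of_nat (Suc r)) * mon (add_mset (Suc a) (add_mset (Suc s) M))
     + cst c * mon (add_mset d M) + der (Qder k d f) (mon M)"
    using Qpol_bin[of k r s] unfolding Q_def d_def[symmetric] f_def[symmetric]
    by (simp add: mon_add_mset r distrib_right mult.assoc c_def)
  then have "cst (of_nat (Suc s)) * mon (add_mset a (add_mset (Suc (Suc s)) M))
    = Q k d f (mon M) - cst (of_nat (Suc r)) * mon (add_mset (Suc a) (add_mset (Suc s) M))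
     - cst c * mon (add_mset d M) - der (Qder k d f) (mon M)"
    by (simp add: algebra_simps)
  also have "\<dots> \<in> red k"
    by (intro red_diff red_cst 1 2 3 4)
  finally have "cst (1 / of_nat (Suc s)) * (cst (of_nat (Suc s)) * mon (add_mset a (add_mset (Suc (Suc s)) M))) \<in> red k"
    by (rule red_cst)
  then show ?case
    by (simp only: mult.assoc[symmetric] cst_mult[symmetric]) (simp del: of_nat_Suc)
qed

text \<open>The coefficient with which \<open>x\<^bsub>n+2\<^esub>\<close> occurs in \<open>L(-2) x\<^sub>n\<close> after reduction to length one.\<close>
lemma length_one_coeff_nonzero:
  fixes k n :: nat
  assumes "k \<ge> 3" "n \<ge> 1"
  defines "e \<equiv> (-1) ^ (n - 1) :: real"
  shows "real n + real n * (real n + 1) - (1 - 1 / (4 * real k)) * (2 * real k * (real n * (real n + 1) / 2 + e)) \<noteq> 0"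
proof -
  define t where "t = real n * real n"
  have t: "real n * (real n + 1) = t + real n" by (simp add: t_def algebra_simps)
  \<comment> \<open>Since 2k - 1/2 is at least 11/2, it suffices that 11/2 times A = n(n + 1)/2 + e
    exceeds n + n(n + 1). The parity of n decides the sign e; for even n the bound n \<ge> 2 makes
    up for e = -1.\<close>
  have e: "real n * (real n + 1) / 2 + e > 0 \<and> 11 / 2 * (real n * (real n + 1) / 2 + e) > real n + real n * (real n + 1)"
  proof (cases "odd n")
    case True
    then have "e = 1" by (simp add: e_def)
    have "t \<ge> 0" "real n \<ge> 0" by (simp_all add: t_def)
    then show ?thesis unfolding \<open>e = 1\<close> t by (simp add: field_simps)
  next
    case False
    then have "n \<ge> 2" using assms(2) by (cases "n = 1") auto
    have "odd (n - 1)" using False assms(2) by simp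
    then have "e = - 1" by (simp add: e_def)
    have "t \<ge> 2 * real n" "real n \<ge> 2" using \<open>n \<ge> 2\<close> by (simp_all add: t_def)
    then show ?thesis unfolding \<open>e = - 1\<close> t by (simp add: field_simps)
  qed
  define A where "A = real n * (real n + 1) / 2 + e"
  have "(1 - 1 / (4 * real k)) * (2 * real k * A) = (2 * real k - 1 / 2) * A"
    using assms(1) by (simp add: field_simps)
  moreover have "(2 * real k - 1 / 2) * A \<ge> 11 / 2 * A"
    using assms(1) e unfolding A_def[symmetric] by (intro mult_right_mono) auto
  ultimately show ?thesis using e unfolding A_def[symmetric] by linarith
qed

text \<open>At a = 0 and at a = d one of the two Heisenberg factors is alpha(0), acting as 2k. The
  two values give the coefficient of x_d in the relation from alpha(-1)alpha(-s-1)1.\<close>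

lemma bin_0_at_0: "bin 0 s (s + 3) 0 = of_nat (Suc s) * (of_nat (Suc s) + 1) / 2"
proof -
  have "(of_int (int (s + 3) - 0 - 1) :: complex) = of_nat (s + 2)" by simp
  then have "bin 0 s (s + 3) 0 = of_nat ((s + 2) choose s)"
    by (simp only: bin_def binomial_gbinomial) simp
  also have "(s + 2) choose s = (s + 2) choose 2"
    using binomial_symmetric[of 2 "s + 2"] by simp
  also have "\<dots> = (Suc s * (s + 2)) div 2"
    by (simp add: choose_two mult.commute)
  also have "of_nat \<dots> = (of_nat (Suc s * (s + 2)) / 2 :: complex)"
  proof -
    have "even (Suc s * (s + 2))" by simp
    then obtain m where "Suc s * (s + 2) = 2 * m" by blast
    then show ?thesis by (simp only:) simp
  qed
  finally show ?thesis by (simp add: algebra_simps)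
qed

lemma bin_0_at_d: "bin 0 s (s + 3) (int (s + 3)) = (-1) ^ s"
  by (simp add: bin_def gbinomial_minus[of 1] flip: binomial_gbinomial)

text \<open>For d \<ge> 3 and n = d - 2, four elements of \<open>red\<close> involve only x_d and
  the products x_1 x_(n+1), x_1^2 x_n and x_2 x_n. Eliminating the products leaves a nonzero
  multiple of x_d. The two smallest cases come from L(-1)1 and from L(-2)1 corrected by
  L(-1)x_1.\<close>

lemma red_var:
  assumes k: "k \<ge> 3" and n: "n \<ge> 1"
  shows "var n \<in> red k"
  using n
proof (induction n rule: less_induct)
  case (less d)
  have k0: "k > 0" using k by simp
  consider "d = 1" | "d = 2" | "d \<ge> 3"
    using less.prems by linarith
  then show ?case
  proof cases
    case 1
    have "vir1 k 1 \<in> red k" by (rule red_vir1) (metis cst_1 posf_cst)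
    then show ?thesis using 1 by (simp add: vir1_eq[OF k0])
  next
    case 2
    let ?c = "1 / of_nat (4 * k) :: complex"
    have "vir2 k 1 \<in> red k" using red_vac[of 1 k] by simp
    moreover have "vir1 k (var 1) \<in> red k" by (rule red_vir1) simp
    ultimately have "vir2 k 1 - cst ?c * vir1 k (var 1) \<in> red k" by (intro red_diff red_cst)
    also have "vir2 k 1 - cst ?c * vir1 k (var 1) = cst (1 - ?c) * var 2"
      by (simp add: vir1_eq[OF k0] vir2_eq[OF k0] cst_diff algebra_simps numeral_2_eq_2)
    finally have "cst (1 / (1 - ?c)) * (cst (1 - ?c) * var 2) \<in> red k" by (rule red_cst)
    moreover have "1 - ?c \<noteq> 0"
      using k by (simp add: field_simps) (metis of_nat_1 of_nat_eq_iff of_nat_mult of_nat_numeral mult_eq_1_iff numeral_eq_one_iff semiring_norm(85) nat_mult_eq_1_iff)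
    ultimately show ?thesis
      unfolding 2 by (simp only: mult.assoc[symmetric] cst_mult[symmetric]) (simp split: if_splits)
  next
    case 3
    then obtain s where s: "d = s + 3"
      by (metis le_add_diff_inverse2)
    define n where "n = Suc s"
    have d: "d = n + 2" by (simp add: s n_def)
    let ?c = "1 / of_nat (4 * k) :: complex"
    let ?b = "of_nat n * (of_nat n + 1) / 2 + (-1) ^ s :: complex"
    have A: "var 1 * var (n + 1) + cst (of_nat (n + 1)) * var d \<in> red k"
      using red_vir1[of "var (n + 1)" k] by (simp add: vir1_eq[OF k0] d)
    have B: "var 1 * var 1 * var n + var 2 * var n + cst (of_nat n) * (var 1 * var (n + 1)) \<in> red k"
      using red_vir1[of "var 1 * var n" k]
      by (simp add: vir1_eq[OF k0] der_mult posf_mult n_def numeral_2_eq_2 algebra_simps)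
    have C: "cst (of_nat n) * (var 1 * var (n + 1)) + var 2 * var n + cst (2 * of_nat k * ?b) * var d \<in> red k"
      using red_Q[of 1 k 0 s] Qpol_bin[of k 0 s] unfolding Q_def
      by (simp add: bin_0_at_0 bin_0_at_d[simplified] n_def s posf_def numeral_2_eq_2 cst_of_nat[of 1, simplified] del: of_nat_Suc)
        (simp add: numeral_2_eq_2)
    \<comment> \<open>This is L(-2) x_n, which lies in \<open>red\<close> by the induction
      hypothesis and stability under L(-2).\<close>
    have D: "var 2 * var n + cst ?c * (var 1 * var 1 * var n) + cst (of_nat n) * var d \<in> red k"
      using red_vir2[OF k0 less.IH[of n]]
      by (simp add: d n_def vir2_eq[OF k0] algebra_simps)
    define e where "e = of_nat n + of_nat n * (of_nat n + 1) - (1 - ?c) * (2 * of_nat k * ?b)"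
    \<comment> \<open>The multipliers are forced: cancelling x_1^2 x_n takes 1/(4k) times B, then
      x_2 x_n takes 1 - 1/(4k) times C, and finally x_1 x_(n+1) takes n times A.\<close>
    have comb: "(var 2 * var n + cst ?c * (var 1 * var 1 * var n) + cst (of_nat n) * var d)
       - cst ?c * (var 1 * var 1 * var n + var 2 * var n + cst (of_nat n) * (var 1 * var (n + 1)))
       - cst (1 - ?c) * (cst (of_nat n) * (var 1 * var (n + 1)) + var 2 * var n + cst (2 * of_nat k * ?b) * var d)
       + cst (of_nat n) * (var 1 * var (n + 1) + cst (of_nat (n + 1)) * var d) = cst e * var d"
      unfolding e_def cst_diff cst_add[of "of_nat n"] cst_mult[of "of_nat n"] cst_mult[of "1 - ?c"]
      by (simp add: cst_diff cst_add algebra_simps)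
    have "cst (1 / e) * (cst e * var d) \<in> red k"
      unfolding comb[symmetric] by (intro red_add red_diff red_cst A B C D)
    moreover have "e \<noteq> 0"
    proof -
      have "e = of_real (real n + real n * (real n + 1)
          - (1 - 1 / (4 * real k)) * (2 * real k * (real n * (real n + 1) / 2 + (-1) ^ (n - 1))))"
        by (simp add: e_def n_def)
      then show ?thesis
        using length_one_coeff_nonzero[OF k, of n] by (simp only: of_real_eq_0_iff) (simp add: n_def)
    qed
    ultimately show ?thesis
      by (simp only: mult.assoc[symmetric] cst_mult[symmetric]) simp
  qed
qed

lemma red_mon:
  assumes k: "k \<ge> 3" and "posm M"
  shows "mon M \<in> red k"
  using assms(2)
proof (induction M rule: measure_induct_rule[of size])
  case (less M)
  consider "M = {#}" | n where "M = {#n#}" | a b N where "M = add_mset a (add_mset b N)"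
    by (metis multiset_cases)
  then show ?case
  proof cases
    case 1
    then show ?thesis using red_vac[of 0 k] by simp
  next
    case (2 n)
    then show ?thesis using red_var[OF k, of n] less.prems by (simp add: var_def)
  next
    case (3 a b N)
    then obtain b' where b': "b = Suc b'" using less.prems by (cases b) auto
    show ?thesis unfolding 3 b'
      using k less.prems by (intro red_length_step less.IH) (auto simp: 3)
  qed
qed

theorem posf_in_red:
  assumes "k \<ge> 3" "posf g"
  shows "g \<in> red k"
proof (induction rule: fock_induct[where g = g])
  case (mon M)
  then show ?case using assms red_mon by (simp add: posf_def)
qed (auto intro: red_0 red_cst red_add)

section \<open>Modes of vectors of charge zero\<close>

text \<open>Every Heisenberg mode sends a basis vector to a multiple of a basis vector.
  \<open>acoef\<close> is the scalar and \<open>amset\<close> the new multiset; \<open>fcoef\<close>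
  and \<open>fmset\<close> follow them along a word of modes.\<close>

definition acoef :: "nat \<Rightarrow> int \<Rightarrow> nat multiset \<Rightarrow> int \<Rightarrow> complex" where
  "acoef k j M c = (if j < 0 then 1 else if j = 0 then of_int (2 * int k * c)
     else of_int (2 * int k * j) * of_nat (count M (nat j)))"

definition amset :: "int \<Rightarrow> nat multiset \<Rightarrow> nat multiset" where
  "amset j M = (if j < 0 then add_mset (nat (- j)) M else if j = 0 then M else M - {#nat j#})"

fun fcoef :: "nat \<Rightarrow> int list \<Rightarrow> nat multiset \<Rightarrow> int \<Rightarrow> complex" where
  "fcoef k [] M c = 1"
| "fcoef k (j # js) M c = acoef k j M c * fcoef k js (amset j M) c"

fun fmset :: "int list \<Rightarrow> nat multiset \<Rightarrow> nat multiset" where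
  "fmset [] M = M"
| "fmset (j # js) M = fmset js (amset j M)"

lemma lift_smult_bv: "lift f (smult a (bv b)) = smult a (f b)"
proof -
  have "supp (smult a (bv b)) = (if a = 0 then {} else {b})"
    by (auto simp: supp_def smult_def bv_def)
  then show ?thesis by (simp add: lift_def) (simp add: smult_def bv_def)
qed

lemma smult_smult: "smult a (smult b v) = smult (a * b) v"
  by (simp add: smult_def mult.assoc)

lemma smult_1 [simp]: "smult 1 v = v"
  by (simp add: smult_def)

lemma smult_0 [simp]: "smult 0 v = (\<lambda>_. 0)"
  by (simp add: smult_def)

lemma amode_smult_bv: "amode k j (smult a (bv (M, c))) = smult (a * acoef k j M c) (bv (amset j M, c))"
  by (simp add: amode_def lift_smult_bv alpha_b_def acoef_def amset_def smult_smult)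

lemma fold_amode_smult_bv:
  "fold (amode k) js (smult a (bv (M, c))) = smult (a * fcoef k js M c) (bv (fmset js M, c))"
  by (induction js arbitrary: a M) (simp_all add: amode_smult_bv mult.assoc)

lemma fold_amode_bv: "fold (amode k) js (bv (M, c)) = smult (fcoef k js M c) (bv (fmset js M, c))"
  using fold_amode_smult_bv[of k js 1] by simp

lemma posm_fmset: "posm M \<Longrightarrow> posm (fmset js M)"
  by (induction js arbitrary: M) (auto simp: amset_def posm_diff)

text \<open>The involution theta anticommutes with every alpha(j): creation and annihilation change
  the length by one, and alpha(0) changes sign with the charge.\<close>

lemma acoef_parity:
  "acoef k j M (- c) * (- 1) ^ size M = - (acoef k j M c * (- 1) ^ size (amset j M))"
proof -
  have "(- 1 :: complex) ^ size M = - ((- 1) ^ size (M - {#nat j#}))" if "nat j \<in># M"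
    using size_Suc_Diff1[OF that] by (metis power_Suc mult_minus1)
  then show ?thesis
    by (cases "nat j \<in># M") (auto simp: acoef_def amset_def not_in_iff)
qed

lemma fcoef_parity:
  "fcoef k js M (- c) * (- 1) ^ size M = (- 1) ^ length js * (fcoef k js M c * (- 1) ^ size (fmset js M))"
proof (induction js arbitrary: M)
  case (Cons j js)
  have "fcoef k (j # js) M (- c) * (- 1) ^ size M
      = fcoef k js (amset j M) (- c) * (acoef k j M (- c) * (- 1) ^ size M)"
    by simp
  also have "\<dots> = - (acoef k j M c * (fcoef k js (amset j M) (- c) * (- 1) ^ size (amset j M)))"
    unfolding acoef_parity by simp
  also have "\<dots> = (- 1) ^ length (j # js) * (fcoef k (j # js) M c * (- 1) ^ size (fmset (j # js) M))"
    unfolding Cons.IH by simp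
  finally show ?case .
qed simp

section \<open>Trivial exponential factors and the coefficients of the mode expansion\<close>

lemma partitions_0: "partitions 0 = {{#}}"
proof
  show "partitions 0 \<subseteq> {{#}}"
  proof
    fix P assume "P \<in> partitions 0"
    then show "P \<in> {{#}}" by (cases P) (auto simp: partitions_def)
  qed
qed (simp add: partitions_def)

lemma empty_in_partitions: "{#} \<in> partitions l \<longleftrightarrow> l = 0"
  by (auto simp: partitions_def)

lemma expcoef_empty [simp]: "expcoef a {#} = 1"
  by (simp add: expcoef_def)

lemma expcoef_0: "expcoef 0 P = (if P = {#} then 1 else 0)"
  by (auto simp: expcoef_def multiset_nonemptyE)

lemma Splus_0: "Splus k 0 l (smult a (bv b)) = smult (if l = 0 then a else 0) (bv b)"
  by (cases "l = 0")
    (auto simp: Splus_def partitions_0 expcoef_0 empty_in_partitions fun_eq_iff intro!: sum.neutral)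

lemma Sminus_0: "Sminus k 0 l (smult a (bv b)) = smult (if l = 0 then a else 0) (bv b)"
  by (cases "l = 0")
    (auto simp: Sminus_def partitions_0 expcoef_0 empty_in_partitions fun_eq_iff intro!: sum.neutral)

lemma shiftL_smult_bv: "shiftL b (smult a (bv (M, c))) = smult a (bv (M, c + b))"
  by (simp add: shiftL_def lift_smult_bv)

definition nonneg :: "int list \<Rightarrow> int list" where "nonneg js = filter (\<lambda>j. 0 \<le> j) js"
definition neg :: "int list \<Rightarrow> int list" where "neg js = filter (\<lambda>j. j < 0) js"

definition tmset :: "int list \<Rightarrow> nat multiset \<Rightarrow> nat multiset" where
  "tmset js M = fmset (neg js) (fmset (nonneg js) M)"

definition bprod :: "nat multiset \<Rightarrow> int list \<Rightarrow> complex" where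
  "bprod Mv js = (\<Prod>t<size Mv. (of_int (- (js ! t) - 1) gchoose (sorted_list_of_multiset Mv ! t - 1)))"

definition tcond :: "nat multiset \<Rightarrow> int \<Rightarrow> int list \<Rightarrow> int \<Rightarrow> bool" where
  "tcond Mv p js e \<longleftrightarrow> length js = size Mv \<and>
     (\<Sum>t<size Mv. - (js ! t) - int (sorted_list_of_multiset Mv ! t)) + e = - p - 1"

text \<open>For a vector of charge zero both exponentials are trivial, which forces i = l = 0;
  \<open>mode_term\<close> is then this scalar times the basis vector with multiset
  \<open>tmset\<close>.\<close>

definition tcoef :: "nat \<Rightarrow> nat multiset \<Rightarrow> int \<Rightarrow> nat multiset \<Rightarrow> int \<Rightarrow> int list \<times> nat \<times> nat \<Rightarrow> complex" where
  "tcoef k Mv p M c = (\<lambda>(js, i, l). if tcond Mv p js 0 \<and> i = 0 \<and> l = 0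
     then bprod Mv js * fcoef k (nonneg js) M c * fcoef k (neg js) (fmset (nonneg js) M) c else 0)"

lemma length_sorted_list_of_multiset [simp]: "length (sorted_list_of_multiset M) = size M"
  by (metis mset_sorted_list_of_multiset size_mset)

lemma mode_term_charge_0:
  "mode_term k (Mv, 0) p (M, c) (js, i, l) = smult (tcoef k Mv p M c (js, i, l)) (bv (tmset js M, c))"
  by (simp add: mode_term_def Let_def tcoef_def tcond_def bprod_def tmset_def nonneg_def neg_def
      fold_amode_bv fold_amode_smult_bv Splus_0 Sminus_0 shiftL_smult_bv smult_smult mult.assoc)

text \<open>Each of the \<open>size Mv\<close> Heisenberg factors contributes a sign -1 when moved
  past theta, and these signs cancel for even size.\<close>

lemma tcoef_parity:
  assumes "even (size Mv)"
  shows "tcoef k Mv p M (- c) (js, i, l) * (- 1) ^ size M = tcoef k Mv p M c (js, i, l) * (- 1) ^ size (tmset js M)"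
proof (cases "tcond Mv p js 0")
  case True
  let ?M = "fmset (nonneg js) M"
  have "length (nonneg js) + length (neg js) = size Mv"
    using sum_length_filter_compl[of "\<lambda>j. 0 \<le> j" js] True
    by (simp add: nonneg_def neg_def tcond_def not_le)
  then have s: "(- 1 :: complex) ^ length (nonneg js) * (- 1) ^ length (neg js) = 1"
    using assms by (simp flip: power_add)
  have "fcoef k (nonneg js) M (- c) * fcoef k (neg js) ?M (- c) * (- 1) ^ size M
    = (- 1) ^ length (nonneg js) * fcoef k (nonneg js) M c * (fcoef k (neg js) ?M (- c) * (- 1) ^ size ?M)"
    using fcoef_parity[of k "nonneg js" M c] by (simp add: ac_simps)
  also have "\<dots> = ((- 1) ^ length (nonneg js) * (- 1) ^ length (neg js))
     * (fcoef k (nonneg js) M c * fcoef k (neg js) ?M c * (- 1) ^ size (tmset js M))"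
    unfolding fcoef_parity by (simp add: tmset_def ac_simps)
  finally show ?thesis using s by (simp add: tcoef_def mult.assoc)
qed (simp add: tcoef_def)

lemma tcoef_uminus_eq_0:
  "even (size Mv) \<Longrightarrow> tcoef k Mv p M (- c) x = 0 \<longleftrightarrow> tcoef k Mv p M c x = 0"
  using tcoef_parity[of Mv k p M c "fst x" "fst (snd x)" "snd (snd x)"] by auto

lemma smult_bv_eq_0: "smult a (bv b) = (\<lambda>_. 0) \<longleftrightarrow> a = 0"
  by (auto simp: smult_def bv_def dest: fun_cong[of _ _ b])

lemma mode_basis_charge_0:
  "mode_basis k (Mv, 0) p (M, c) (N, c') =
    (if c' = c then \<Sum>x | tcoef k Mv p M c x \<noteq> 0. if tmset (fst x) M = N then tcoef k Mv p M c x else 0 else 0)"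
proof -
  have eq: "mode_term k (Mv, 0) p (M, c) x = smult (tcoef k Mv p M c x) (bv (tmset (fst x) M, c))" for x
    by (cases x) (simp add: mode_term_charge_0)
  show ?thesis
    unfolding mode_basis_def eq smult_bv_eq_0
    by (auto simp: smult_def bv_def intro!: sum.cong sum.neutral)
qed

lemma mode_basis_parity:
  assumes "even (size Mv)"
  shows "mode_basis k (Mv, 0) p (M, - c) (N, - c') * (- 1) ^ size M
    = mode_basis k (Mv, 0) p (M, c) (N, c') * (- 1) ^ size N"
proof -
  have "(if tmset (fst x) M = N then tcoef k Mv p M (- c) x else 0) * (- 1) ^ size M
      = (if tmset (fst x) M = N then tcoef k Mv p M c x else 0) * (- 1) ^ size N" for x
    using tcoef_parity[OF assms, of k p M c "fst x" "fst (snd x)" "snd (snd x)"] by auto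
  then show ?thesis
    by (simp add: mode_basis_charge_0 tcoef_uminus_eq_0[OF assms] sum_distrib_right)
qed

section \<open>Embedding of the polynomial algebra into the theta-invariants\<close>

definition iota :: "fock \<Rightarrow> vec" where
  "iota g = (\<lambda>(M, c). if c = 1 then lookup g M else if c = - 1 then (- 1) ^ size M * lookup g M else 0)"

lemma iota_add: "iota (g + h) = vadd (iota g) (iota h)"
  by (auto simp: iota_def vadd_def fun_eq_iff lookup_add algebra_simps)

lemma iota_cst: "iota (cst c * g) = smult c (iota g)"
  by (auto simp: iota_def smult_def fun_eq_iff)

lemma iota_0: "iota 0 = (\<lambda>_. 0)"
  by (auto simp: iota_def fun_eq_iff)

lemma supp_iota: "supp (iota g) = keys g \<times> {1, - 1}"
  by (auto simp: supp_def iota_def in_keys_iff split: if_splits)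

lemma finite_supp_iota: "finite (supp (iota g))"
  by (simp add: supp_iota)

text \<open>The sign at charge -1 in \<open>iota\<close> is the one that theta-invariance
  demands.\<close>

lemma iota_in_VLplus: "posf g \<Longrightarrow> iota g \<in> VLplus"
  using finite_supp_iota[of g]
  by (auto simp: VLplus_def VL_def theta_def fun_eq_iff iota_def posf_def posm_def in_keys_iff
      simp flip: mult.assoc power_add split: if_splits)

lemma ex_iota:
  assumes "finite {M. v (M, 1) \<noteq> 0}" "\<And>M. v (M, 1) \<noteq> 0 \<Longrightarrow> posm M"
    "\<And>M. v (M, - 1) = (- 1) ^ size M * v (M, 1)" "\<And>M c. c \<noteq> 1 \<Longrightarrow> c \<noteq> - 1 \<Longrightarrow> v (M, c) = 0"
  shows "\<exists>g. posf g \<and> v = iota g"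
proof (intro exI conjI)
  let ?g = "Abs_poly_mapping (\<lambda>M. v (M, 1))"
  have l: "lookup ?g M = v (M, 1)" for M
    using assms(1) by simp
  show "posf ?g" using assms(2) by (auto simp: posf_def in_keys_iff l)
  show "v = iota ?g" using assms(3,4) by (auto simp: fun_eq_iff iota_def l)
qed

lemma Evec_eq_iota: "Evec = iota 1"
  by (auto simp: Evec_def iota_def vadd_def bv_def fun_eq_iff lookup_one when_def)

text \<open>The two summands give u + u' at charge 1 and u - u' at charge -1, where u has even and
  u' odd length; so they are the even and odd parts of the polynomial.\<close>

lemma VLplus1_eq: "VLplus1 = iota ` {g. posf g}"
proof (intro equalityI subsetI)
  fix v assume "v \<in> VLplus1"
  then obtain u u' where v: "v = vadd (tens u Elat) (tens u' Flat)" and u: "u \<in> M1plus" "u' \<in> M1minus"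
    by (auto simp: VLplus1_def)
  have 1: "(- 1) ^ size M * u M = u M" for M
    using u(1) by (auto simp: M1plus_def thetaM_def fun_eq_iff)
  have 2: "(- 1) ^ size M * u' M = - u' M" for M
    using u(2) by (auto simp: M1minus_def thetaM_def fun_eq_iff)
  have v1: "v (M, c) = (if c = 1 then u M + u' M else if c = - 1 then u M - u' M else 0)" for M c
    by (simp add: v vadd_def tens_def Elat_def Flat_def)
  have "\<exists>g. posf g \<and> v = iota g"
  proof (rule ex_iota)
    have "{M. v (M, 1) \<noteq> 0} \<subseteq> {M. u M \<noteq> 0} \<union> {M. u' M \<noteq> 0}"
      by (auto simp: v1)
    then show "finite {M. v (M, 1) \<noteq> 0}"
      by (rule finite_subset) (use u in \<open>auto simp: M1plus_def M1minus_def M1_def\<close>)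
    show "posm M" if "v (M, 1) \<noteq> 0" for M
    proof -
      have "u M \<noteq> 0 \<or> u' M \<noteq> 0" using that by (auto simp: v1)
      then show ?thesis using u by (auto simp: M1plus_def M1minus_def M1_def posm_def)
    qed
  qed (simp_all add: v1 distrib_left 1 2)
  then show "v \<in> iota ` {g. posf g}" by blast
next
  fix v assume "v \<in> iota ` {g. posf g}"
  then obtain g where g: "posf g" "v = iota g" by auto
  define u where "u = (\<lambda>M. if even (size M) then lookup g M else 0)"
  define u' where "u' = (\<lambda>M. if odd (size M) then lookup g M else 0)"
  have "finite {M. lookup g M \<noteq> 0}" by simp
  then have "finite {M. u M \<noteq> 0}" "finite {M. u' M \<noteq> 0}"
    unfolding u_def u'_def by (auto intro: rev_finite_subset[of "{M. lookup g M \<noteq> 0}"])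
  then have "u \<in> M1plus" "u' \<in> M1minus"
    using g(1) by (auto simp: M1plus_def M1minus_def M1_def u_def u'_def thetaM_def fun_eq_iff
        posf_def posm_def in_keys_iff split: if_splits)
  moreover have "v = vadd (tens u Elat) (tens u' Flat)"
    by (auto simp: g(2) iota_def vadd_def tens_def Elat_def Flat_def fun_eq_iff u_def u'_def)
  ultimately show "v \<in> VLplus1" by (auto simp: VLplus1_def)
qed

text \<open>\<open>M(1)\<^sup>+\<close> is spanned by the basis vectors of charge zero and even length.\<close>
definition even_charge_0 :: "vec \<Rightarrow> bool" where
  "even_charge_0 u \<longleftrightarrow> (\<forall>M c. u (M, c) \<noteq> 0 \<longrightarrow> c = 0 \<and> even (size M))"

text \<open>Charge zero modes preserve the charge, so only the half of \<open>iota g\<close> with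
  charge \<open>c\<close> contributes.\<close>

lemma vmode_iota:
  assumes u: "even_charge_0 u"
  shows "vmode k u p (iota g) (N, c) = (if c = 1 \<or> c = - 1
    then \<Sum>b\<in>supp u. \<Sum>M\<in>keys g. u b * iota g (M, c) * mode_basis k b p (M, c) (N, c) else 0)"
proof -
  have "(\<Sum>w\<in>supp (iota g). u b * iota g w * mode_basis k b p w (N, c))
     = (if c = 1 \<or> c = - 1 then \<Sum>M\<in>keys g. u b * iota g (M, c) * mode_basis k b p (M, c) (N, c) else 0)"
    if "b \<in> supp u" for b
  proof -
    obtain Mv e where "b = (Mv, e)" by (cases b)
    moreover from this have "e = 0"
      using that u by (simp add: supp_def even_charge_0_def)
    ultimately have b: "b = (Mv, 0)" by simp
    have "(\<Sum>w\<in>supp (iota g). u b * iota g w * mode_basis k b p w (N, c))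
      = (\<Sum>M\<in>keys g. \<Sum>c'\<in>{1, - 1}. u b * iota g (M, c') * mode_basis k b p (M, c') (N, c))"
      unfolding supp_iota by (subst sum.cartesian_product) (simp add: case_prod_beta)
    also have "\<dots> = (\<Sum>M\<in>keys g. if c = 1 \<or> c = - 1 then u b * iota g (M, c) * mode_basis k b p (M, c) (N, c) else 0)"
      by (intro sum.cong) (auto simp: b mode_basis_charge_0)
    finally show ?thesis by auto
  qed
  then show ?thesis
    unfolding vmode_def by (auto intro: sum.cong)
qed

text \<open>A sum over an infinite index set is 0 by convention, so a nonzero coefficient already
  implies that there are only finitely many terms; \<open>N\<close> is then the multiset of one of
  them.\<close>

lemma mode_basis_support:
  assumes "posm M"
  shows "finite {N. mode_basis k (Mv, 0) p (M, c) (N, c) \<noteq> 0}"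
    and "mode_basis k (Mv, 0) p (M, c) (N, c) \<noteq> 0 \<Longrightarrow> posm N"
proof -
  let ?X = "{x. tcoef k Mv p M c x \<noteq> 0}"
  have *: "finite ?X \<and> N \<in> (\<lambda>x. tmset (fst x) M) ` ?X" if "mode_basis k (Mv, 0) p (M, c) (N, c) \<noteq> 0" for N
  proof -
    have n: "(\<Sum>x\<in>?X. if tmset (fst x) M = N then tcoef k Mv p M c x else 0) \<noteq> 0"
      using that by (simp add: mode_basis_charge_0)
    then have "finite ?X" by (meson sum.infinite)
    moreover obtain x where x: "x \<in> ?X" "(if tmset (fst x) M = N then tcoef k Mv p M c x else 0) \<noteq> 0"
      by (rule sum.not_neutral_contains_not_neutral[OF n])
    moreover have "N = tmset (fst x) M"
      using x(2) by (metis (full_types))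
    ultimately show ?thesis by blast
  qed
  show "finite {N. mode_basis k (Mv, 0) p (M, c) (N, c) \<noteq> 0}"
  proof (cases "finite ?X")
    case True
    then show ?thesis using * by (intro finite_subset[OF _ finite_imageI[OF True]]) blast
  next
    case False
    with * have "{N. mode_basis k (Mv, 0) p (M, c) (N, c) \<noteq> 0} = {}" by blast
    then show ?thesis by simp
  qed
  show "posm N" if "mode_basis k (Mv, 0) p (M, c) (N, c) \<noteq> 0"
    using *[OF that] assms by (auto simp: tmset_def posm_fmset)
qed

text \<open>Closure of V_L^+(1) under the modes of M(1)^+: charge is preserved, even length gives
  theta-invariance, and supports stay finite. It applies to J_(-1) without computing its
  action.\<close>

lemma vmode_even_charge_0:
  assumes u: "even_charge_0 u" "finite (supp u)" and g: "posf g"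
  shows "\<exists>h. posf h \<and> vmode k u p (iota g) = iota h"
proof (rule ex_iota)
  have c0: "snd b = 0 \<and> even (size (fst b))" if "b \<in> supp u" for b
    using that u(1) by (cases b) (auto simp: supp_def even_charge_0_def)
  have nz: "\<exists>b\<in>supp u. \<exists>M\<in>keys g. mode_basis k b p (M, 1) (N, 1) \<noteq> 0"
    if "vmode k u p (iota g) (N, 1) \<noteq> 0" for N
  proof (rule ccontr)
    assume "\<not> ?thesis"
    then have "vmode k u p (iota g) (N, 1) = 0"
      by (simp add: vmode_iota[OF u(1)])
    with that show False by simp
  qed
  show "finite {N. vmode k u p (iota g) (N, 1) \<noteq> 0}"
  proof (rule finite_subset)
    show "{N. vmode k u p (iota g) (N, 1) \<noteq> 0}
      \<subseteq> (\<Union>b\<in>supp u. \<Union>M\<in>keys g. {N. mode_basis k (fst b, 0) p (M, 1) (N, 1) \<noteq> 0})"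
    proof
      fix N assume "N \<in> {N. vmode k u p (iota g) (N, 1) \<noteq> 0}"
      then obtain b M where "b \<in> supp u" "M \<in> keys g" "mode_basis k b p (M, 1) (N, 1) \<noteq> 0"
        using nz by blast
      then show "N \<in> (\<Union>b\<in>supp u. \<Union>M\<in>keys g. {N. mode_basis k (fst b, 0) p (M, 1) (N, 1) \<noteq> 0})"
        using c0[of b] by (cases b) force
    qed
    show "finite (\<Union>b\<in>supp u. \<Union>M\<in>keys g. {N. mode_basis k (fst b, 0) p (M, 1) (N, 1) \<noteq> 0})"
      using u(2) g by (intro finite_UN_I mode_basis_support(1)) (auto simp: posf_def)
  qed
  show "posm N" if N: "vmode k u p (iota g) (N, 1) \<noteq> 0" for N
  proof -
    obtain b M where "b \<in> supp u" "M \<in> keys g" "mode_basis k b p (M, 1) (N, 1) \<noteq> 0"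
      using nz[OF N] by blast
    then show ?thesis
      using c0[of b] g mode_basis_support(2)[of M k "fst b" p 1 N] by (cases b) (auto simp: posf_def)
  qed
  show "vmode k u p (iota g) (N, - 1) = (- 1) ^ size N * vmode k u p (iota g) (N, 1)" for N
  proof -
    have "u b * iota g (M, - 1) * mode_basis k b p (M, - 1) (N, - 1)
        = (- 1) ^ size N * (u b * iota g (M, 1) * mode_basis k b p (M, 1) (N, 1))"
      if "b \<in> supp u" for b M
      using mode_basis_parity[of "fst b" k p M 1 N 1] c0[OF that]
      by (cases b) (simp add: iota_def ac_simps)
    then have "(\<Sum>b\<in>supp u. \<Sum>M\<in>keys g. u b * iota g (M, - 1) * mode_basis k b p (M, - 1) (N, - 1))
        = (\<Sum>b\<in>supp u. \<Sum>M\<in>keys g. (- 1) ^ size N * (u b * iota g (M, 1) * mode_basis k b p (M, 1) (N, 1)))"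
      by (intro sum.cong refl)
    then show ?thesis
      by (simp add: vmode_iota[OF u(1)] sum_distrib_left)
  qed
  show "vmode k u p (iota g) (M, c) = 0" if "c \<noteq> 1" "c \<noteq> - 1" for M c
    using that by (simp add: vmode_iota[OF u(1)])
qed

section \<open>Modes of quadratic vectors\<close>

lemma iota_eqI: "(\<And>N. lookup g N = lookup h N) \<Longrightarrow> iota g = iota h"
  by (rule arg_cong[of g h iota]) (rule poly_mapping_eqI)

lemma sum_mset_count:
  fixes h :: "'a \<Rightarrow> 'b :: comm_semiring_1"
  assumes "finite A" "set_mset M \<subseteq> A"
  shows "(\<Sum>n\<in>#M. h n) = (\<Sum>n\<in>A. of_nat (count M n) * h n)"
  using assms(2)
proof (induction M)
  case (add x M)
  have "(\<Sum>n\<in>A. of_nat (count (add_mset x M) n) * h n)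
    = (\<Sum>n\<in>A. of_nat (count M n) * h n + (if n = x then h n else 0))"
    by (intro sum.cong) (auto simp: algebra_simps)
  then show ?case using add assms(1) by (simp add: sum.distrib add.commute)
qed simp

text \<open>The two mode indices add up to -d < 0, so at most one of them annihilates. For -d < j <
  0 both create, at j = 0 and j = -d one acts as 2k, and the remaining j form the derivation part.
  The window contains every index at which a part of \<open>M\<close> can be removed.\<close>

lemma Q_mon_expand:
  assumes M: "posm M" and d: "d \<ge> 1"
  shows "Q k d f (mon M) = (\<Sum>j\<in>{- int d - int (sum_mset M)..int (sum_mset M)}.
    cst (f (- j) * (fcoef k (nonneg [j, - int d - j]) M 1
       * fcoef k (neg [j, - int d - j]) (fmset (nonneg [j, - int d - j]) M) 1)) * mon (tmset [j, - int d - j] M))"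
    (is "_ = (\<Sum>j\<in>?J. ?t j)")
proof -
  define B where "B = sum_mset M"
  have B: "set_mset M \<subseteq> {1..B}"
  proof
    fix n assume "n \<in># M"
    then show "n \<in> {1..B}" using M by (auto simp: B_def posm_def dest!: multi_member_split)
  qed
  have inner: "?t (- int a) = cst (f (int a)) * (var a * var (d - a)) * mon M" if "a \<in> {1..<d}" for a
    using that by (simp add: nonneg_def neg_def tmset_def acoef_def amset_def mon_add_mset nat_diff_distrib ac_simps
        flip: of_nat_diff)
  have zero: "?t 0 = cst (f 0 * (2 * of_nat k)) * (var d * mon M)"
    using d by (simp add: nonneg_def neg_def tmset_def acoef_def amset_def mon_add_mset)
  have md: "?t (- int d) = cst (f (int d) * (2 * of_nat k)) * (var d * mon M)"
    using d by (simp add: nonneg_def neg_def tmset_def acoef_def amset_def mon_add_mset)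
  have pos: "?t (int n) = of_nat (count M n) * (cst (2 * of_nat k * of_nat n * f (- int n)) * (var (d + n) * mon (M - {#n#})))"
    if "n \<in> {1..B}" for n
  proof -
    have "nat (int d + int n) = d + n" by simp
    then show ?thesis
      using that by (simp add: nonneg_def neg_def tmset_def acoef_def amset_def mon_add_mset cst_mult cst_of_nat ac_simps)
  qed
  have negt: "?t (- int d - int n) = of_nat (count M n) * (cst (2 * of_nat k * of_nat n * f (int d + int n)) * (var (d + n) * mon (M - {#n#})))"
    if "n \<in> {1..B}" for n
  proof -
    have "nat (int d + int n) = d + n" by simp
    then show ?thesis
      using that by (simp add: nonneg_def neg_def tmset_def acoef_def amset_def mon_add_mset cst_mult cst_of_nat ac_simps)
  qed
  have J: "?J = (\<lambda>n. - int d - int n) ` {1..B} \<union> ({- int d} \<union> ((\<lambda>a. - int a) ` {1..<d} \<union> ({0} \<union> int ` {1..B})))"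
  proof (intro equalityI subsetI)
    fix j assume j: "j \<in> ?J"
    consider "j < - int d" | "j = - int d" | "- int d < j" "j < 0" | "j = 0" | "0 < j" by linarith
    then show "j \<in> (\<lambda>n. - int d - int n) ` {1..B} \<union> ({- int d} \<union> ((\<lambda>a. - int a) ` {1..<d} \<union> ({0} \<union> int ` {1..B})))"
    proof cases
      case 1
      then have "j = - int d - int (nat (- j - int d))" "nat (- j - int d) \<in> {1..B}"
        using j by (auto simp: B_def simp del: of_nat_sum_mset)
      then show ?thesis by blast
    next
      case 3
      then have "j = - int (nat (- j))" "nat (- j) \<in> {1..<d}" by auto
      then show ?thesis by blast
    next
      case 5
      then have "j = int (nat j)" "nat j \<in> {1..B}" using j by (auto simp: B_def simp del: of_nat_sum_mset)
      then show ?thesis by blast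
    qed auto
  qed (auto simp: B_def simp del: of_nat_sum_mset)
  have split: "(\<Sum>j\<in>?J. T j) = (\<Sum>n\<in>{1..B}. T (- int d - int n)) + (T (- int d)
     + ((\<Sum>a\<in>{1..<d}. T (- int a)) + (T 0 + (\<Sum>n\<in>{1..B}. T (int n)))))" for T :: "int \<Rightarrow> fock"
  proof -
    have "(\<Sum>j\<in>?J. T j) = (\<Sum>j\<in>(\<lambda>n. - int d - int n) ` {1..B}. T j) + (T (- int d)
     + ((\<Sum>j\<in>(\<lambda>a. - int a) ` {1..<d}. T j) + (T 0 + (\<Sum>j\<in>int ` {1..B}. T j))))"
      unfolding J using d by (subst sum.union_disjoint; fastforce?)+
    then show ?thesis
      by (simp add: sum.reindex inj_on_def)
  qed
  have "(\<Sum>j\<in>?J. ?t j) = (\<Sum>n\<in>{1..B}. ?t (- int d - int n)) + (?t (- int d)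
     + ((\<Sum>a\<in>{1..<d}. ?t (- int a)) + (?t 0 + (\<Sum>n\<in>{1..B}. ?t (int n)))))"
    by (rule split)
  also have "\<dots> = (\<Sum>n\<in>{1..B}. of_nat (count M n) * (cst (2 * of_nat k * of_nat n * f (int d + int n)) * (var (d + n) * mon (M - {#n#}))))
     + (cst (f (int d) * (2 * of_nat k)) * (var d * mon M)
     + ((\<Sum>a\<in>{1..<d}. cst (f (int a)) * (var a * var (d - a)) * mon M)
     + (cst (f 0 * (2 * of_nat k)) * (var d * mon M)
     + (\<Sum>n\<in>{1..B}. of_nat (count M n) * (cst (2 * of_nat k * of_nat n * f (- int n)) * (var (d + n) * mon (M - {#n#})))))))"
    using inner zero md pos negt by (simp only: cong: sum.cong)
  also have "\<dots> = Qpol k d f * mon M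
     + (\<Sum>n\<in>{1..B}. of_nat (count M n) * (Qder k d f n * mon (M - {#n#})))"
    by (simp add: Qpol_def Qder_def distrib_left distrib_right cst_add sum.distrib sum_distrib_right mult.assoc)
      (simp add: ac_simps)
  also have "(\<Sum>n\<in>{1..B}. of_nat (count M n) * (Qder k d f n * mon (M - {#n#}))) = der (Qder k d f) (mon M)"
    using sum_mset_count[OF _ B, of "\<lambda>n. Qder k d f n * mon (M - {#n#})"] by (simp add: der_mon)
  finally show ?thesis by (simp add: Q_def)
qed

text \<open>The degree condition determines the second mode index as -d - j, so a single integer j
  indexes the terms. The order m \<le> n fixes how the sorted list assigns the two
  binomials.\<close>

lemma mode_basis_quadratic:
  assumes M: "posm M" and mn: "m \<le> n" and d: "d \<ge> 1" "int d = int (Suc m) + int (Suc n) - p - 1"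
  shows "mode_basis k ({#Suc m, Suc n#}, 0) p (M, 1) (N, 1) = lookup (Q k d (bin m n d) (mon M)) N"
proof -
  let ?Mv = "{#Suc m, Suc n#}"
  let ?J = "{- int d - int (sum_mset M)..int (sum_mset M)}"
  define pt where "pt j = ([j, - int d - j], 0::nat, 0::nat)" for j
  define C where "C j = bin m n d (- j) * (fcoef k (nonneg [j, - int d - j]) M 1
       * fcoef k (neg [j, - int d - j]) (fmset (nonneg [j, - int d - j]) M) 1)" for j
  have srt: "sorted_list_of_multiset ?Mv = [Suc m, Suc n]"
    using mn by (simp add: sorted_list_of_multiset_insert)
  have cond: "tcond ?Mv p js 0 \<longleftrightarrow> (\<exists>j. js = [j, - int d - j])" for js
    using d(2) by (auto simp: tcond_def srt numeral_2_eq_2 length_Suc_conv)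
  have coef: "tcoef k ?Mv p M 1 (pt j) = C j" for j
  proof -
    have "bprod ?Mv [j, - int d - j] = bin m n d (- j)"
      unfolding bprod_def srt by (simp add: bin_def numeral_2_eq_2 algebra_simps)
    moreover have "tcond ?Mv p [j, - int d - j] 0" using cond by blast
    ultimately show ?thesis by (simp add: tcoef_def pt_def C_def)
  qed
  \<comment> \<open>Outside the window one index exceeds every part of \<open>M\<close> and
    annihilates the monomial.\<close>
  have outside: "j \<in> ?J" if "C j \<noteq> 0" for j
  proof (rule ccontr)
    assume j: "j \<notin> ?J"
    have le: "n \<le> sum_mset M" if "n \<in># M" for n
      using that by (auto dest!: multi_member_split)
    consider "j > int (sum_mset M)" | "j < - int d - int (sum_mset M)" using j by force
    then show False
    proof cases
      case 1
      then have "nat j \<notin># M" using le[of "nat j"] by (auto simp del: of_nat_sum_mset)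
      then show ?thesis using that 1 by (auto simp: C_def nonneg_def acoef_def not_in_iff)
    next
      case 2
      then have "nat (- int d - j) \<notin># M" using le[of "nat (- int d - j)"] by (auto simp del: of_nat_sum_mset)
      then show ?thesis using that 2 by (auto simp: C_def nonneg_def acoef_def not_in_iff)
    qed
  qed
  have "{x. tcoef k ?Mv p M 1 x \<noteq> 0} = pt ` {j. C j \<noteq> 0}"
  proof (intro equalityI subsetI)
    fix x assume x: "x \<in> {x. tcoef k ?Mv p M 1 x \<noteq> 0}"
    obtain js i l where xs: "x = (js, i, l)" by (cases x)
    from x obtain j where "x = pt j"
      unfolding xs by (auto simp: tcoef_def cond pt_def split: if_splits)
    with x show "x \<in> pt ` {j. C j \<noteq> 0}" using coef by auto
  qed (auto simp: coef)
  then have "mode_basis k (?Mv, 0) p (M, 1) (N, 1)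
     = (\<Sum>x\<in>pt ` {j. C j \<noteq> 0}. if tmset (fst x) M = N then tcoef k ?Mv p M 1 x else 0)"
    by (simp add: mode_basis_charge_0)
  also have "\<dots> = (\<Sum>j | C j \<noteq> 0. if tmset [j, - int d - j] M = N then C j else 0)"
  proof -
    have "inj_on pt A" for A by (auto simp: inj_on_def pt_def)
    moreover have "fst (pt j) = [j, - int d - j]" for j by (simp add: pt_def)
    ultimately show ?thesis by (simp only: sum.reindex o_def coef)
  qed
  also have "\<dots> = (\<Sum>j\<in>?J. if tmset [j, - int d - j] M = N then C j else 0)"
    using outside by (intro sum.mono_neutral_left) auto
  also have "\<dots> = lookup (Q k d (bin m n d) (mon M)) N"
    unfolding Q_mon_expand[OF M d(1)] lookup_sum
    by (intro sum.cong) (auto simp: lookup_mon C_def)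
  finally show ?thesis .
qed

lemma Q_linear: "Q k d f g = (\<Sum>M\<in>keys g. cst (lookup g M) * Q k d f (mon M))"
proof -
  have "Q k d f (\<Sum>M\<in>A. cst (lookup g M) * mon M) = (\<Sum>M\<in>A. cst (lookup g M) * Q k d f (mon M))" for A
  proof (induction A rule: infinite_finite_induct)
    case (insert x A)
    then show ?case by (simp add: Q_add Q_cst)
  qed (simp_all add: Q_def)
  then show ?thesis by (metis fock_expand)
qed

text \<open>Exchanges the commuting factors alpha(-a) and alpha(a-d); this settles the case m > n
  below.\<close>

lemma Q_reflect: "Q k d (\<lambda>a. f (int d - a)) g = Q k d f g"
proof -
  have "(\<Sum>a=1..<d. cst (f (int d - int a)) * (var a * var (d - a))) = (\<Sum>a=1..<d. cst (f (int a)) * (var a * var (d - a)))"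
    by (rule sum.reindex_bij_witness[of _ "\<lambda>a. d - a" "\<lambda>a. d - a"]) (auto simp: of_nat_diff mult.commute)
  then have "Qpol k d (\<lambda>a. f (int d - a)) = Qpol k d f"
    by (simp add: Qpol_def add.commute)
  moreover have "Qder k d (\<lambda>a. f (int d - a)) = Qder k d f"
    by (simp add: Qder_def fun_eq_iff add.commute)
  ultimately show ?thesis by (simp add: Q_def)
qed

lemma even_charge_0_smult_bv:
  assumes "even (size M)"
  shows "even_charge_0 (smult a (bv (M, 0)))" "finite (supp (smult a (bv (M, 0))))"
proof -
  show "even_charge_0 (smult a (bv (M, 0)))"
    using assms by (auto simp: even_charge_0_def smult_def bv_def split: if_splits)
  have "supp (smult a (bv (M, 0))) \<subseteq> {(M, 0)}"
    by (auto simp: supp_def smult_def bv_def split: if_splits)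
  then show "finite (supp (smult a (bv (M, 0))))" by (rule finite_subset) simp
qed

text \<open>For p = -2 this identifies \<open>red_Q\<close> as an element of C_2, and for p = -1 and
  m = n = 0 it yields L(-2).\<close>

lemma vmode_quadratic:
  assumes g: "posf g" and d: "d \<ge> 1" "int d = int (Suc m) + int (Suc n) - p - 1"
  shows "vmode k (smult a (bv ({#Suc m, Suc n#}, 0))) p (iota g) = iota (cst a * Q k d (bin m n d) g)"
proof -
  have *: "vmode k (smult a (bv ({#Suc m, Suc n#}, 0))) p (iota g) = iota (cst a * Q k d (bin m n d) g)"
    if mn: "m \<le> n" and d: "d \<ge> 1" "int d = int (Suc m) + int (Suc n) - p - 1" for m n
  proof -
    let ?u = "smult a (bv ({#Suc m, Suc n#}, 0))"
    have ev: "even_charge_0 ?u" "finite (supp ?u)"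
      by (rule even_charge_0_smult_bv; simp)+
    obtain h where h: "vmode k ?u p (iota g) = iota h"
      using vmode_even_charge_0[OF ev g] by blast
    have "iota h = iota (cst a * Q k d (bin m n d) g)"
    proof (rule iota_eqI)
      fix N
      have "lookup h N = vmode k ?u p (iota g) (N, 1)"
        unfolding h by (simp add: iota_def)
      also have "\<dots> = (\<Sum>b\<in>supp ?u. \<Sum>M\<in>keys g. ?u b * lookup g M * mode_basis k b p (M, 1) (N, 1))"
        unfolding vmode_iota[OF ev(1)] by (simp add: iota_def)
      also have "\<dots> = (\<Sum>b\<in>{({#Suc m, Suc n#}, 0)}. \<Sum>M\<in>keys g. ?u b * lookup g M * mode_basis k b p (M, 1) (N, 1))"
        by (intro sum.mono_neutral_left) (auto simp: supp_def smult_def bv_def split: if_splits)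
      also have "\<dots> = (\<Sum>M\<in>keys g. a * (lookup g M * lookup (Q k d (bin m n d) (mon M)) N))"
        using g mn d by (auto intro!: sum.cong simp: smult_def bv_def posf_def mode_basis_quadratic mult.assoc)
      also have "\<dots> = a * lookup (Q k d (bin m n d) g) N"
        by (subst Q_linear[of k d _ g]) (simp add: lookup_sum sum_distrib_left)
      finally show "lookup h N = lookup (cst a * Q k d (bin m n d) g) N" by simp
    qed
    then show ?thesis using h by simp
  qed
  show ?thesis
  proof (cases "m \<le> n")
    case True
    then show ?thesis using * d by blast
  next
    case False
    have "bin m n d = (\<lambda>a. bin n m d (int d - a))"
      by (simp add: bin_def fun_eq_iff algebra_simps)
    then have "Q k d (bin m n d) g = Q k d (bin n m d) g"
      using Q_reflect[of k d "bin n m d" g] by simp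
    moreover have "vmode k (smult a (bv ({#Suc n, Suc m#}, 0))) p (iota g) = iota (cst a * Q k d (bin n m d) g)"
      using False d by (intro *) auto
    ultimately show ?thesis by (simp add: add_mset_commute)
  qed
qed

lemma Lm2_iota:
  assumes "posf g"
  shows "Lm2 k (iota g) = iota (vir2 k g)"
proof -
  have "Lm2 k (iota g) = iota (cst (1 / of_nat (4 * k)) * Q k 2 (bin 0 0 2) g)"
    unfolding Lm2_def omega_def using vmode_quadratic[OF assms, of 2 0 0 "-1" k "1 / of_nat (4 * k)"] by simp
  also have "cst (1 / of_nat (4 * k)) * Q k 2 (bin 0 0 2) g = vir2 k g"
    using Q_fun_comb[of k 2 "1 / of_nat (4 * k)" "bin 0 0 2" 0 "bin 0 0 2" g]
    by (simp add: vir2_def bin_def)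
  finally show ?thesis .
qed

section \<open>Modes acting on the vacuum\<close>

lemma Sminus_1: "Sminus k b 1 (smult a (bv (M, c))) = smult (of_int b * a) (bv (add_mset 1 M, c))"
proof -
  have "partitions 1 = {{#1#}}"
  proof (intro equalityI subsetI)
    fix P assume P: "P \<in> partitions 1"
    then obtain x R where "P = add_mset x R" by (cases P) (auto simp: partitions_def)
    then have R: "0 < x" "x + sum_mset R = 1" "\<forall>m\<in>#R. 0 < m"
      using P by (simp_all add: partitions_def)
    then have "x = 1" "sum_mset R = 0" by linarith+
    then have "x = 1" "R \<in> partitions 0" using R(3) by (simp_all only: partitions_def mem_Collect_eq simp_thms)
    then show "P \<in> {{#1#}}" using \<open>P = add_mset x R\<close> partitions_0 by simp
  qed (simp add: partitions_def)
  then show ?thesis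
    by (simp add: Sminus_def expcoef_def amode_smult_bv acoef_def amset_def) (simp add: smult_def mult.assoc)
qed

lemma Sminus_1_bv: "Sminus k b (Suc 0) (bv (M, c)) = smult (of_int b) (bv (add_mset 1 M, c))"
  using Sminus_1[of k b 1 M c] by simp

lemma fcoef_vacuum: "js \<noteq> [] \<Longrightarrow> \<forall>j\<in>set js. 0 \<le> j \<Longrightarrow> fcoef k js {#} 0 = 0"
  by (cases js) (auto simp: acoef_def)

text \<open>Positive modes kill the vacuum, so only the empty partition contributes.\<close>

lemma Splus_vacuum: "Splus k b l (smult a (bv ({#}, 0))) = smult (if l = 0 then a else 0) (bv ({#}, 0))"
proof (cases "l = 0")
  case True
  then show ?thesis by (simp add: Splus_def partitions_0)
next
  case False
  have "fold (\<lambda>m. amode k (int m)) (sorted_list_of_multiset P) (smult a (bv ({#}, 0))) = (\<lambda>_. 0)"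
    if "P \<in> partitions l" for P
  proof -
    have "P \<noteq> {#}" using that False by (auto simp: partitions_def)
    then have "map int (sorted_list_of_multiset P) \<noteq> []"
      by (metis map_is_Nil_conv mset.simps(1) mset_sorted_list_of_multiset)
    then have "fcoef k (map int (sorted_list_of_multiset P)) {#} 0 = 0"
      by (intro fcoef_vacuum) auto
    moreover have "fold (\<lambda>m. amode k (int m)) (sorted_list_of_multiset P) = fold (amode k) (map int (sorted_list_of_multiset P))"
      by (simp add: fold_map o_def)
    ultimately show ?thesis by (simp add: fold_amode_smult_bv)
  qed
  then show ?thesis using False by (auto simp: Splus_def fun_eq_iff intro!: sum.neutral)
qed

lemma neg_list:
  assumes "\<forall>j\<in>set js. j < 0"
  shows "fcoef k js M c = 1" "fmset js M = M + mset (map (\<lambda>j. nat (- j)) js)"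
  using assms by (induction js arbitrary: M) (auto simp: acoef_def amset_def)

lemma gchoose_nonneg_eq_0:
  assumes "0 \<le> j" "j < int m"
  shows "(of_int j gchoose m :: complex) = 0"
proof -
  have "(of_int j :: complex) = of_nat (nat j)" using assms by simp
  then show ?thesis using assms by (simp only: binomial_gbinomial[symmetric]) (simp add: binomial_eq_0)
qed

lemma sum_int_eq_1:
  fixes f :: "nat \<Rightarrow> int"
  assumes "finite A" "\<And>t. t \<in> A \<Longrightarrow> f t \<ge> 0" "sum f A = 1"
  obtains s where "s \<in> A" "f s = 1" "\<And>t. t \<in> A \<Longrightarrow> t \<noteq> s \<Longrightarrow> f t = 0"
proof -
  obtain s where s: "s \<in> A" "f s \<noteq> 0"
    using assms(3) by (metis sum.neutral zero_neq_one)
  have rem: "sum f A = f s + sum f (A - {s})" using s assms(1) by (simp add: sum.remove)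
  have nn: "sum f (A - {s}) \<ge> 0" using assms(2) by (intro sum_nonneg) auto
  have 1: "f s = 1" using rem nn assms(2)[OF s(1)] s(2) assms(3) by linarith
  then have "sum f (A - {s}) = 0" using rem assms(3) by simp
  then have "\<forall>t\<in>A - {s}. f t = 0"
    using assms(1,2) by (subst (asm) sum_nonneg_eq_0_iff) auto
  with s(1) 1 show ?thesis by (intro that[of s]) auto
qed

text \<open>This is L(-1) of the basis vector with multiset \<open>M\<close> and charge
  \<open>c\<close>. The sum runs over positions of the sorted list, as the terms of the mode
  expansion do.\<close>

definition vacuum_sum :: "int \<Rightarrow> nat multiset \<Rightarrow> fock" where
  "vacuum_sum c M = cst (of_int c) * mon (add_mset 1 M)
     + (\<Sum>t<size M. cst (of_nat (sorted_list_of_multiset M ! t))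
          * mon (add_mset (Suc (sorted_list_of_multiset M ! t)) (M - {#sorted_list_of_multiset M ! t#})))"

lemma nth_sorted_list_of_multiset_in: "t < size M \<Longrightarrow> sorted_list_of_multiset M ! t \<in># M"
  by (metis length_sorted_list_of_multiset nth_mem set_sorted_list_of_multiset)

text \<open>On the vacuum all chosen modes must be negative and l = 0. The binomials make each
  excess -j_t - m_t nonnegative, and by degree the excesses and i add up to 1. Either i = 1, which
  gives c x_1, or one excess is 1, with binomial binom(m_t, m_t - 1) = m_t.\<close>

lemma mode_basis_vacuum:
  assumes M: "posm M"
  shows "mode_basis k (M, c) (- 2) ({#}, 0) (N, c') = (if c' = c then lookup (vacuum_sum c M) N else 0)"
proof -
  define ms where "ms = sorted_list_of_multiset M"
  define r where "r = size M"
  have len: "length ms = r" by (simp add: ms_def r_def)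
  have mset_ms: "mset ms = M" by (simp add: ms_def)
  have pos: "ms ! t > 0" if "t < r" for t
    using that M nth_sorted_list_of_multiset_in[of t M] by (auto simp: r_def ms_def posm_def)
  let ?T = "mode_term k (M, c) (- 2) ({#}, 0)"
  \<comment> \<open>\<open>js0\<close> has no excess, and \<open>jst t\<close> has excess 1 at
    position t alone.\<close>
  define js0 where "js0 = map (\<lambda>m. - int m) ms"
  define jst where "jst t = js0[t := - int (Suc (ms ! t))]" for t
  have eq: "?T (js, i, l) = (if tcond M (- 2) js (int i - int l) then
      smult (bprod M js) (fold (amode k) (neg js) (Sminus k c i (smult (if l = 0 then fcoef k (nonneg js) {#} 0 else 0)
         (bv (fmset (nonneg js) {#}, c))))) else (\<lambda>_. 0))" for js i l
  proof (cases "nonneg js = []")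
    case True
    have "?T (js, i, l) = (if tcond M (- 2) js (int i - int l) then
      smult (bprod M js) (fold (amode k) (neg js) (Sminus k c i (shiftL c (Splus k c l
        (fold (amode k) (nonneg js) (bv ({#}, 0))))))) else (\<lambda>_. 0))"
      by (simp add: mode_term_def Let_def tcond_def bprod_def nonneg_def neg_def)
    then show ?thesis using Splus_vacuum[of k c l 1] True by (simp add: shiftL_smult_bv)
  next
    case False
    then have 0: "fcoef k (nonneg js) {#} 0 = 0" by (rule fcoef_vacuum) (auto simp: nonneg_def)
    then have "fold (amode k) (nonneg js) (bv ({#}, 0)) = smult 0 (bv ({#}, 0))"
      by (simp add: fold_amode_bv)
    then have "?T (js, i, l) = (if tcond M (- 2) js (int i - int l) then
      smult (bprod M js) (fold (amode k) (neg js) (Sminus k c i (shiftL c (Splus k c l (smult 0 (bv ({#}, 0))))))) else (\<lambda>_. 0))"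
      by (simp add: mode_term_def Let_def tcond_def bprod_def flip: nonneg_def neg_def)
    moreover have "shiftL c (Splus k c l (smult 0 (bv ({#}, 0)))) = smult 0 (bv ({#}, c))"
      unfolding Splus_vacuum shiftL_smult_bv by simp
    ultimately show ?thesis using 0 by simp
  qed
  have Sm: "fold (amode k) js' (Sminus k c i (smult 0 (bv (N', c)))) = (\<lambda>_. 0)" for js' i N'
  proof -
    have "fold (amode k) js' (smult 0 (bv (M', c))) = (\<lambda>_. 0)" for js' M'
      unfolding fold_amode_smult_bv by simp
    then have *: "fold (amode k) js' (\<lambda>_. 0) = (\<lambda>_. 0)" for js'
      by simp
    moreover have "fold (\<lambda>m. amode k (- int m)) xs (\<lambda>_. 0) = (\<lambda>_. 0)" for xs
      using *[of "map (\<lambda>m. - int m) xs"] by (simp add: fold_map o_def)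
    ultimately show ?thesis by (simp add: Sminus_def)
  qed
  have support: "(js = js0 \<and> i = 1 \<and> l = 0) \<or> (\<exists>t<r. js = jst t \<and> i = 0 \<and> l = 0)"
    if nz: "?T (js, i, l) \<noteq> (\<lambda>_. 0)" for js i l
  proof -
    have cond: "tcond M (- 2) js (int i - int l)" and b: "bprod M js \<noteq> 0"
      using nz unfolding eq by (auto split: if_splits)
    have f: "(if l = 0 then fcoef k (nonneg js) {#} 0 else 0) \<noteq> 0"
    proof
      assume "(if l = 0 then fcoef k (nonneg js) {#} 0 else 0) = 0"
      then show False using nz Sm[of "neg js" i "fmset (nonneg js) {#}"] unfolding eq
        by (simp add: smult_def split: if_splits)
    qed
    then have l: "l = 0" by (auto split: if_splits)
    have nn: "nonneg js = []"
    proof (rule ccontr)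
      assume "nonneg js \<noteq> []"
      then have "fcoef k (nonneg js) {#} 0 = 0" by (rule fcoef_vacuum) (auto simp: nonneg_def)
      with f show False by (simp split: if_splits)
    qed
    have neg: "j < 0" if "j \<in> set js" for j
      using that nn by (auto simp: nonneg_def filter_empty_conv not_le)
    have lj: "length js = r" and s: "(\<Sum>t<r. - (js ! t) - int (ms ! t)) + int i = 1"
      using cond l by (auto simp: tcond_def r_def ms_def)
    \<comment> \<open>Otherwise 0 \<le> -j_t - 1 < m_t - 1 and the binomial vanishes.\<close>
    have ge: "- (js ! t) - int (ms ! t) \<ge> 0" if t: "t < r" for t
    proof (rule ccontr)
      assume "\<not> ?thesis"
      then have "(of_int (- (js ! t) - 1) gchoose (ms ! t - 1) :: complex) = 0"
        using neg[of "js ! t"] t lj pos[OF t] by (intro gchoose_nonneg_eq_0) auto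
      then have "bprod M js = 0"
        using t by (auto simp: bprod_def r_def ms_def)
      with b show False by simp
    qed
    show ?thesis
    proof (cases "i = 0")
      case False
      have "(\<Sum>t<r. - (js ! t) - int (ms ! t)) \<ge> 0" using ge by (intro sum_nonneg) auto
      then have "i = 1" "(\<Sum>t<r. - (js ! t) - int (ms ! t)) = 0" using s False by linarith+
      moreover from this have "\<forall>t\<in>{..<r}. - (js ! t) - int (ms ! t) = 0"
        using ge by (subst (asm) sum_nonneg_eq_0_iff) auto
      then have "js ! t = - int (ms ! t)" if "t < r" for t using that by force
      then have "js = js0" using lj len by (intro nth_equalityI) (auto simp: js0_def)
      ultimately show ?thesis using l by simp
    next
      case True
      then have "(\<Sum>t<r. - (js ! t) - int (ms ! t)) = 1" using s by simp
      then obtain t where t: "t \<in> {..<r}" "- (js ! t) - int (ms ! t) = 1"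
        and t': "\<And>t'. t' \<in> {..<r} \<Longrightarrow> t' \<noteq> t \<Longrightarrow> - (js ! t') - int (ms ! t') = 0"
        by (rule sum_int_eq_1[of "{..<r}" "\<lambda>t. - (js ! t) - int (ms ! t)", rotated 2]) (use ge in auto)
      have "js = jst t"
      proof (rule nth_equalityI)
        fix u assume u: "u < length js"
        then show "js ! u = jst t ! u"
          using t t'[of u] lj len by (cases "u = t") (auto simp: jst_def js0_def)
      qed (use lj len in \<open>simp add: jst_def js0_def\<close>)
      then show ?thesis using t(1) l True by blast
    qed
  qed
  have val: "?T (js, i, 0) = smult (bprod M js) (Sminus k c i (smult 1 (bv (mset (map (\<lambda>j. nat (- j)) js), c))))"
    if "tcond M (- 2) js (int i)" "\<forall>j\<in>set js. j < 0" "i \<le> 1" for js i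
  proof -
    have n: "nonneg js = []" "neg js = js"
      using that(2) by (auto simp: nonneg_def neg_def filter_empty_conv filter_id_conv)
    have "i = 0 \<or> i = 1" using that(3) by linarith
    then show ?thesis
    proof
      assume i: "i = 0"
      have S0: "Sminus k c 0 v = v" for v by (simp add: Sminus_def partitions_0)
      show ?thesis
        using that(1) neg_list[OF that(2)] unfolding i by (simp add: eq n S0 fold_amode_bv)
    next
      assume i: "i = 1"
      show ?thesis
        using that(1) neg_list[OF that(2)] unfolding i by (simp add: eq n Sminus_1_bv fold_amode_smult_bv)
    qed
  qed
  have neg0: "\<forall>j\<in>set js0. j < 0" using M by (auto simp: js0_def ms_def posm_def)
  have bin1: "(of_int (- (- int m) - 1) gchoose (m - 1) :: complex) = 1" if "m > 0" for m
  proof -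
    have "(of_int (- (- int m) - 1) :: complex) = of_nat (m - 1)" using that by (simp add: of_nat_diff)
    then show ?thesis by (simp only: binomial_gbinomial[symmetric]) simp
  qed
  have T0: "?T (js0, 1, 0) = smult (of_int c) (bv (add_mset 1 M, c))"
  proof -
    have "bprod M js0 = 1"
      unfolding bprod_def using pos bin1 by (intro prod.neutral) (auto simp: js0_def len r_def simp flip: ms_def)
    moreover have "tcond M (- 2) js0 (int 1)"
      by (simp add: tcond_def js0_def len[unfolded r_def] flip: ms_def)
    moreover have "mset (map (\<lambda>j. nat (- j)) js0) = M"
      by (simp add: js0_def o_def mset_ms)
    ultimately show ?thesis using val[of js0 1] neg0 by (simp add: Sminus_1_bv)
  qed
  have Tt: "?T (jst t, 0, 0) = smult (of_nat (ms ! t)) (bv (add_mset (Suc (ms ! t)) (M - {#ms ! t#}), c))"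
    if t: "t < r" for t
  proof -
    have nth: "jst t ! u = (if u = t then - int (Suc (ms ! t)) else - int (ms ! u))" if "u < r" for u
      using that t len by (simp add: jst_def js0_def)
    have "bprod M (jst t) = (\<Prod>u<r. if u = t then of_nat (ms ! t) else 1)"
      unfolding bprod_def r_def[symmetric] ms_def[symmetric]
    proof (intro prod.cong refl)
      fix u assume u: "u \<in> {..<r}"
      show "of_int (- (jst t ! u) - 1) gchoose (ms ! u - 1) = (if u = t then of_nat (ms ! t) else 1 :: complex)"
      proof (cases "u = t")
        case True
        have "(of_int (- (jst t ! t) - 1) :: complex) = of_nat (ms ! t)"
          using t by (simp add: nth)
        then have "of_int (- (jst t ! t) - 1) gchoose (ms ! t - 1) = (of_nat (ms ! t choose (ms ! t - 1)) :: complex)"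
          by (simp only: binomial_gbinomial)
        also have "ms ! t choose (ms ! t - 1) = ms ! t"
          using binomial_symmetric[of 1 "ms ! t"] pos[OF t] by simp
        finally show ?thesis using True by simp
      next
        case False
        then show ?thesis using bin1[OF pos[of u]] u by (simp add: nth)
      qed
    qed
    then have "bprod M (jst t) = of_nat (ms ! t)" using t by simp
    moreover have "tcond M (- 2) (jst t) (int 0)"
    proof -
      have "(\<Sum>u<r. - (jst t ! u) - int (ms ! u)) = (\<Sum>u<r. if u = t then 1 else 0)"
        by (intro sum.cong) (auto simp: nth)
      then show ?thesis using t len
        unfolding tcond_def r_def[symmetric] ms_def[symmetric] by (simp add: jst_def js0_def)
    qed
    moreover have "\<forall>j\<in>set (jst t). j < 0"
      using neg0 set_update_subset_insert[of js0 t] by (fastforce simp: jst_def)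
    moreover have "mset (map (\<lambda>j. nat (- j)) (jst t)) = add_mset (Suc (ms ! t)) (M - {#ms ! t#})"
    proof -
      have "map (\<lambda>j. nat (- j)) (jst t) = ms[t := Suc (ms ! t)]"
        by (simp add: jst_def js0_def map_update o_def nat_add_distrib)
      then show ?thesis using t len mset_update[of t ms] by (simp add: mset_ms)
    qed
    moreover have "Sminus k c 0 v = v" for v by (simp add: Sminus_def partitions_0)
    ultimately show ?thesis using val[of "jst t" 0] by simp
  qed
  let ?X = "insert (js0, 1, 0) ((\<lambda>t. (jst t, 0, 0)) ` {..<r})"
  \<comment> \<open>Equal parts of \<open>M\<close> at different positions still give different
    index lists, so multiplicities are counted correctly.\<close>
  have inj: "inj_on (\<lambda>t. (jst t, 0::nat, 0::nat)) {..<r}"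
  proof (rule inj_onI)
    fix t u assume tu: "t \<in> {..<r}" "u \<in> {..<r}" "(jst t, 0::nat, 0::nat) = (jst u, 0, 0)"
    show "t = u"
    proof (rule ccontr)
      assume "t \<noteq> u"
      then have "jst u ! t = - int (ms ! t)" "jst t ! t = - int (Suc (ms ! t))"
        using tu(1,2) len by (simp_all add: jst_def js0_def)
      then show False using tu(3) by simp
    qed
  qed
  have "mode_basis k (M, c) (- 2) ({#}, 0) (N, c') = (\<Sum>x\<in>?X. ?T x (N, c'))"
    unfolding mode_basis_def
  proof (rule sum.mono_neutral_left)
    show "{x. ?T x \<noteq> (\<lambda>_. 0)} \<subseteq> ?X"
    proof
      fix x assume "x \<in> {x. ?T x \<noteq> (\<lambda>_. 0)}"
      then show "x \<in> ?X" using support[of "fst x" "fst (snd x)" "snd (snd x)"] by (cases x) auto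
    qed
  qed auto
  also have "\<dots> = ?T (js0, 1, 0) (N, c') + (\<Sum>t<r. ?T (jst t, 0, 0) (N, c'))"
    by (subst sum.insert) (auto simp: sum.reindex[OF inj])
  also have "\<dots> = (if c' = c then lookup (vacuum_sum c M) N else 0)"
    by (auto simp: T0[simplified] Tt smult_def bv_def vacuum_sum_def lookup_add lookup_sum lookup_mon simp flip: ms_def r_def
        intro!: sum.cong sum.neutral)
  finally show ?thesis .
qed

lemma vacuum_sum_1:
  assumes "k > 0"
  shows "vacuum_sum 1 M = vir1 k (mon M)"
proof -
  have "(\<Sum>n\<in>#mset (sorted_list_of_multiset M). cst (of_nat n) * mon (add_mset (Suc n) (M - {#n#})))
    = (\<Sum>t<size M. cst (of_nat (sorted_list_of_multiset M ! t))
          * mon (add_mset (Suc (sorted_list_of_multiset M ! t)) (M - {#sorted_list_of_multiset M ! t#})))"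
    by (simp only: mset_map[symmetric] sum_mset_sum_list sum_list_sum_nth) (simp add: lessThan_atLeast0)
  then show ?thesis
    by (simp add: vacuum_sum_def vir1_eq[OF assms] der_mon mon_add_mset mult.assoc)
qed

text \<open>L(-1) commutes with theta: in the x_1 term the change of length parity is offset by the
  sign of the charge, and the derivation part keeps the length.\<close>

lemma vacuum_sum_parity:
  "(- 1) ^ size M * lookup (vacuum_sum (- 1) M) N = (- 1) ^ size N * lookup (vacuum_sum 1 M) N"
proof -
  have "(- 1) ^ size M * lookup (mon (add_mset (Suc n) (M - {#n#}))) N
      = (- 1) ^ size N * lookup (mon (add_mset (Suc n) (M - {#n#}))) N" if "n \<in># M" for n
    using size_Suc_Diff1[OF that] by (auto simp: lookup_mon)
  then have "(\<Sum>t<size M. of_nat (sorted_list_of_multiset M ! t)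
          * ((- 1) ^ size M * lookup (mon (add_mset (Suc (sorted_list_of_multiset M ! t)) (M - {#sorted_list_of_multiset M ! t#}))) N))
    = (\<Sum>t<size M. of_nat (sorted_list_of_multiset M ! t)
          * ((- 1) ^ size N * lookup (mon (add_mset (Suc (sorted_list_of_multiset M ! t)) (M - {#sorted_list_of_multiset M ! t#}))) N))"
    using nth_sorted_list_of_multiset_in[of _ M] by (intro sum.cong) auto
  moreover have "(- 1) ^ size M * (- lookup (mon (add_mset 1 M)) N) = (- 1) ^ size N * lookup (mon (add_mset 1 M)) N"
    by (auto simp: lookup_mon)
  ultimately show ?thesis
    by (simp add: vacuum_sum_def lookup_add lookup_sum distrib_left sum_distrib_left ac_simps cst_uminus
        Poly_Mapping.lookup_minus right_diff_distrib)
qed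

lemma vir1_linear: "vir1 k g = (\<Sum>M\<in>keys g. cst (lookup g M) * vir1 k (mon M))"
  unfolding vir1_def by (rule Q_linear)

text \<open>The identity h_(-2)1 = L(-1)h, which puts the elements from \<open>red_vir1\<close> into
  C_2.\<close>

lemma vmode_vacuum:
  assumes k: "k > 0" and g: "posf g"
  shows "vmode k (iota g) (- 2) (bv ({#}, 0)) = iota (vir1 k g)"
proof
  fix y :: basis
  obtain N c where y: "y = (N, c)" by (cases y)
  have "supp (bv ({#}, 0)) = {({#}, 0)}" by (auto simp: supp_def bv_def)
  then have "vmode k (iota g) (- 2) (bv ({#}, 0)) y
     = (\<Sum>b\<in>keys g \<times> {1, - 1}. iota g b * mode_basis k b (- 2) ({#}, 0) (N, c))"
    unfolding vmode_def supp_iota by (simp add: bv_def y)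
  also have "\<dots> = (\<Sum>M\<in>keys g. \<Sum>c'\<in>{1, - 1}. iota g (M, c') * mode_basis k (M, c') (- 2) ({#}, 0) (N, c))"
    by (subst sum.cartesian_product) (simp add: case_prod_beta)
  also have "\<dots> = (\<Sum>M\<in>keys g. lookup g M * iota (vir1 k (mon M)) (N, c))"
  proof (intro sum.cong refl)
    fix M assume M: "M \<in> keys g"
    then have "posm M" using g by (simp add: posf_def)
    then show "(\<Sum>c'\<in>{1, - 1}. iota g (M, c') * mode_basis k (M, c') (- 2) ({#}, 0) (N, c))
      = lookup g M * iota (vir1 k (mon M)) (N, c)"
      using vacuum_sum_parity[of M N]
      by (auto simp: mode_basis_vacuum iota_def vacuum_sum_1[OF k])
  qed
  also have "\<dots> = iota (vir1 k g) y"
    by (subst vir1_linear[of k g]) (simp add: iota_def y lookup_sum sum_distrib_left mult.left_commute)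
  finally show "vmode k (iota g) (- 2) (bv ({#}, 0)) y = iota (vir1 k g) y" .
qed

section \<open>Spans\<close>

definition lin_subspace :: "vec set \<Rightarrow> bool" where
  "lin_subspace S \<longleftrightarrow> (\<lambda>_. 0) \<in> S \<and> (\<forall>u\<in>S. \<forall>v\<in>S. vadd u v \<in> S) \<and> (\<forall>u\<in>S. \<forall>a. smult a u \<in> S)"

lemma cspan_base: "u \<in> S \<Longrightarrow> u \<in> cspan S"
  unfolding cspan_def by (auto intro!: exI[of _ "{u}"] exI[of _ "\<lambda>_. 1"])

lemma lin_subspace_cspan: "lin_subspace (cspan S)"
  unfolding lin_subspace_def
proof (intro conjI ballI allI)
  show "(\<lambda>_. 0) \<in> cspan S" unfolding cspan_def by (auto intro!: exI[of _ "{}"])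
next
  fix u v assume "u \<in> cspan S" "v \<in> cspan S"
  then obtain F c G d where F: "finite F" "F \<subseteq> S" "u = (\<lambda>y. \<Sum>w\<in>F. c w * w y)"
    and G: "finite G" "G \<subseteq> S" "v = (\<lambda>y. \<Sum>w\<in>G. d w * w y)"
    by (auto simp: cspan_def)
  define e where "e w = (if w \<in> F then c w else 0) + (if w \<in> G then d w else 0)" for w
  have "vadd u v = (\<lambda>y. \<Sum>w\<in>F \<union> G. e w * w y)"
  proof
    fix y
    have "(\<Sum>w\<in>F. c w * w y) = (\<Sum>w\<in>F \<union> G. (if w \<in> F then c w else 0) * w y)"
      using F(1) G(1) by (intro sum.mono_neutral_cong_left) auto
    moreover have "(\<Sum>w\<in>G. d w * w y) = (\<Sum>w\<in>F \<union> G. (if w \<in> G then d w else 0) * w y)"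
      using F(1) G(1) by (intro sum.mono_neutral_cong_left) auto
    ultimately show "vadd u v y = (\<Sum>w\<in>F \<union> G. e w * w y)"
      by (simp add: vadd_def F(3) G(3) e_def distrib_right sum.distrib)
  qed
  then show "vadd u v \<in> cspan S"
    using F G unfolding cspan_def by (intro CollectI exI[of _ "F \<union> G"] exI[of _ e] conjI) auto
next
  fix u a assume "u \<in> cspan S"
  then obtain F c where F: "finite F" "F \<subseteq> S" "u = (\<lambda>y. \<Sum>w\<in>F. c w * w y)"
    by (auto simp: cspan_def)
  have "smult a u = (\<lambda>y. \<Sum>w\<in>F. (a * c w) * w y)"
    by (simp add: smult_def F(3) sum_distrib_left mult.assoc)
  then show "smult a u \<in> cspan S"
    using F unfolding cspan_def by (intro CollectI exI[of _ F] exI[of _ "\<lambda>w. a * c w"] conjI)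
qed

lemma cspan_subset:
  assumes "lin_subspace T" "S \<subseteq> T"
  shows "cspan S \<subseteq> T"
proof
  fix u assume "u \<in> cspan S"
  then obtain F c where F: "finite F" "F \<subseteq> S" and u: "u = (\<lambda>y. \<Sum>w\<in>F. c w * w y)"
    by (auto simp: cspan_def)
  from F have "(\<lambda>y. \<Sum>w\<in>F. c w * w y) \<in> T"
  proof (induction F rule: finite_induct)
    case empty
    then show ?case using assms(1) by (simp add: lin_subspace_def)
  next
    case (insert w F)
    have "(\<lambda>y. \<Sum>w\<in>insert w F. c w * w y) = vadd (smult (c w) w) (\<lambda>y. \<Sum>w\<in>F. c w * w y)"
      using insert.hyps by (simp add: vadd_def smult_def)
    then show ?case using insert assms by (auto simp: lin_subspace_def)
  qed
  then show "u \<in> T" using u by simp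
qed

lemma cspan_mono: "S \<subseteq> T \<Longrightarrow> cspan S \<subseteq> cspan T"
  unfolding cspan_def by blast

lemma lin_subspace_ssum:
  assumes S: "lin_subspace S" and T: "lin_subspace T"
  shows "lin_subspace (ssum S T)"
  unfolding lin_subspace_def
proof (intro conjI ballI allI)
  have "vadd (\<lambda>_. 0) (\<lambda>_. 0) \<in> ssum S T"
    using assms by (auto simp: ssum_def lin_subspace_def)
  then show "(\<lambda>_. 0) \<in> ssum S T" by (simp add: vadd_def)
next
  fix u v assume "u \<in> ssum S T" "v \<in> ssum S T"
  then obtain a b c d where ab: "a \<in> S" "b \<in> T" "u = vadd a b" and cd: "c \<in> S" "d \<in> T" "v = vadd c d"
    by (auto simp: ssum_def)
  have "vadd u v = vadd (vadd a c) (vadd b d)" by (simp add: ab cd vadd_def algebra_simps)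
  moreover have "vadd a c \<in> S" "vadd b d \<in> T" using ab cd assms by (auto simp: lin_subspace_def)
  ultimately show "vadd u v \<in> ssum S T" by (auto simp: ssum_def)
next
  fix u a assume "u \<in> ssum S T"
  then obtain b c where bc: "b \<in> S" "c \<in> T" "u = vadd b c" by (auto simp: ssum_def)
  have "smult a u = vadd (smult a b) (smult a c)" by (simp add: bc vadd_def smult_def algebra_simps)
  moreover have "smult a b \<in> S" "smult a c \<in> T" using bc assms by (auto simp: lin_subspace_def)
  ultimately show "smult a u \<in> ssum S T" by (auto simp: ssum_def)
qed

lemma ssum_upper:
  assumes "lin_subspace S" "lin_subspace T"
  shows "S \<subseteq> ssum S T" "T \<subseteq> ssum S T"
proof -
  have 0: "(\<lambda>_. 0) \<in> S" "(\<lambda>_. 0) \<in> T" using assms by (simp_all add: lin_subspace_def)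
  have *: "vadd u (\<lambda>_. 0) = u" "vadd (\<lambda>_. 0) u = u" for u by (simp_all add: vadd_def)
  show "S \<subseteq> ssum S T"
  proof
    fix u assume "u \<in> S"
    then have "vadd u (\<lambda>_. 0) \<in> ssum S T" using 0 unfolding ssum_def by blast
    then show "u \<in> ssum S T" by (simp add: *)
  qed
  show "T \<subseteq> ssum S T"
  proof
    fix u assume "u \<in> T"
    then have "vadd (\<lambda>_. 0) u \<in> ssum S T" using 0 unfolding ssum_def by blast
    then show "u \<in> ssum S T" by (simp add: *)
  qed
qed

lemma ssum_least: "lin_subspace U \<Longrightarrow> S \<subseteq> U \<Longrightarrow> T \<subseteq> U \<Longrightarrow> ssum S T \<subseteq> U"
  by (auto simp: ssum_def lin_subspace_def)

section \<open>The spanning statement modulo C_2\<close>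

lemma lin_subspace_VLplus1: "lin_subspace VLplus1"
  unfolding lin_subspace_def VLplus1_eq
  by (auto simp flip: iota_add iota_cst iota_0 intro!: imageI posf_add posf_mult)

lemma lin_subspace_C2: "lin_subspace (C2 k)"
  unfolding C2_def by (rule lin_subspace_cspan)

lemma C2_base: "u \<in> VLplus \<Longrightarrow> v \<in> VLplus \<Longrightarrow> vmode k u (- 2) v \<in> C2 k"
  unfolding C2_def by (rule cspan_base) blast

lemma bv_in_VLplus:
  assumes "posm M" "even (size M)"
  shows "bv (M, 0) \<in> VLplus"
proof -
  have "supp (bv (M, 0)) = {(M, 0)}" by (auto simp: supp_def bv_def)
  then show ?thesis
    using assms by (auto simp: VLplus_def VL_def theta_def bv_def posm_def fun_eq_iff split: if_splits)
qed

lemma Lm2_power_iota: "(Lm2 k ^^ s) (iota 1) = iota ((vir2 k ^^ s) 1) \<and> posf ((vir2 k ^^ s) 1)"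
proof (induction s)
  case 0
  show ?case using posf_cst[of 1] by simp
next
  case (Suc s)
  then show ?case by (simp add: Lm2_iota posf_vir2)
qed

text \<open>Under \<open>iota\<close> the generators of \<open>red\<close> become L(-2)-descendants
  of E, elements h_(-2)1, and elements u_(-2)h with u quadratic in M(1)^+; the last two kinds lie in
  C_2.\<close>

lemma iota_red:
  assumes k: "k > 0" and g: "g \<in> red k"
  shows "iota g \<in> ssum (cspan {(Lm2 k ^^ s) Evec | s. True}) (C2 k)" (is "_ \<in> ?U")
proof -
  have sub: "lin_subspace ?U" by (intro lin_subspace_ssum lin_subspace_cspan lin_subspace_C2)
  have up: "cspan {(Lm2 k ^^ s) Evec | s. True} \<subseteq> ?U" "C2 k \<subseteq> ?U"
    by (intro ssum_upper lin_subspace_cspan lin_subspace_C2)+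
  show ?thesis
    using g
  proof induction
    case red_0
    then show ?case using sub by (simp add: iota_0 lin_subspace_def)
  next
    case (red_add g h)
    then show ?case using sub by (simp add: iota_add lin_subspace_def)
  next
    case (red_cst g c)
    then show ?case using sub by (simp add: iota_cst lin_subspace_def)
  next
    case (red_vac s)
    have "iota ((vir2 k ^^ s) 1) \<in> cspan {(Lm2 k ^^ s) Evec | s. True}"
      by (intro cspan_base CollectI exI[of _ s]) (simp add: Evec_eq_iota Lm2_power_iota)
    then show ?case using up by blast
  next
    case (red_vir1 h)
    have "vmode k (iota h) (- 2) (bv ({#}, 0)) \<in> C2 k"
      by (intro C2_base iota_in_VLplus bv_in_VLplus red_vir1) auto
    then show ?case using up red_vir1 k by (auto simp: vmode_vacuum)
  next
    case (red_Q h r s)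
    have "vmode k (smult 1 (bv ({#Suc r, Suc s#}, 0))) (- 2) (iota h) = iota (cst 1 * Q k (r + s + 3) (bin r s (r + s + 3)) h)"
      by (intro vmode_quadratic red_Q) auto
    moreover have "vmode k (bv ({#Suc r, Suc s#}, 0)) (- 2) (iota h) \<in> C2 k"
      by (intro C2_base iota_in_VLplus bv_in_VLplus red_Q) auto
    ultimately show ?case using up by auto
  qed
qed

lemma Jvec_even_charge_0: "even_charge_0 (Jvec k)" "finite (supp (Jvec k))"
proof -
  have s: "supp (Jvec k) \<subseteq> {({#1, 1, 1, 1#}, 0), ({#3, 1#}, 0), ({#2, 2#}, 0)}"
    by (auto simp: supp_def Jvec_def bv_def)
  then show "finite (supp (Jvec k))" by (rule finite_subset) simp
  show "even_charge_0 (Jvec k)"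
    using s unfolding even_charge_0_def supp_def by (auto dest!: subsetD)
qed

lemma Jm1_VLplus1: "v \<in> VLplus1 \<Longrightarrow> Jm1 k v \<in> VLplus1"
  using vmode_even_charge_0[OF Jvec_even_charge_0] unfolding VLplus1_eq Jm1_def by blast

lemma Lm2_VLplus1: "v \<in> VLplus1 \<Longrightarrow> Lm2 k v \<in> VLplus1"
  unfolding VLplus1_eq using Lm2_iota posf_vir2 by auto

lemma descendants_VLplus1: "(Lm2 k ^^ s) ((Jm1 k ^^ t) Evec) \<in> VLplus1"
proof -
  have "Evec \<in> VLplus1"
    unfolding VLplus1_eq Evec_eq_iota using posf_cst[of 1] by auto
  then have "(Jm1 k ^^ t) Evec \<in> VLplus1"
    by (induction t) (simp_all add: Jm1_VLplus1)
  then show ?thesis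
    by (induction s) (simp_all add: Lm2_VLplus1)
qed

text \<open>Equality of images modulo C_2 is expressed by sums with C_2. Allowing any
  \<open>S\<close> between the L(-2)-descendants and V_L^+(1) covers both families of the
  theorem.\<close>

lemma ssum_VLplus1_C2:
  assumes k: "k \<ge> 3"
    and S: "{(Lm2 k ^^ s) Evec | s. True} \<subseteq> S" "S \<subseteq> VLplus1"
  shows "ssum VLplus1 (C2 k) = ssum (cspan S) (C2 k)"
proof
  have sub: "lin_subspace (ssum (cspan S) (C2 k))" "lin_subspace (ssum VLplus1 (C2 k))"
    by (intro lin_subspace_ssum lin_subspace_cspan lin_subspace_C2 lin_subspace_VLplus1)+
  have "VLplus1 \<subseteq> ssum (cspan {(Lm2 k ^^ s) Evec | s. True}) (C2 k)"
    using posf_in_red[OF k] iota_red[of k] k by (auto simp: VLplus1_eq)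
  also have "\<dots> \<subseteq> ssum (cspan S) (C2 k)"
    using cspan_mono[OF S(1)] by (auto simp: ssum_def)
  finally show "ssum VLplus1 (C2 k) \<subseteq> ssum (cspan S) (C2 k)"
    by (intro ssum_least sub ssum_upper lin_subspace_cspan lin_subspace_C2)
  have "cspan S \<subseteq> ssum VLplus1 (C2 k)"
    using cspan_subset[OF lin_subspace_VLplus1 S(2)] ssum_upper(1)[OF lin_subspace_VLplus1 lin_subspace_C2] by blast
  then show "ssum (cspan S) (C2 k) \<subseteq> ssum VLplus1 (C2 k)"
    by (intro ssum_least sub ssum_upper lin_subspace_VLplus1 lin_subspace_C2)
qed

theorem theorem4p10:
  fixes k :: nat
  assumes "k \<ge> 3"
  shows "(\<not> (\<exists>n::nat. k = n ^ 2) \<longrightarrow>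
            ssum VLplus1 (C2 k) = ssum (cspan {(Lm2 k ^^ s) Evec | s. True}) (C2 k))
       \<and> ((\<exists>n::nat. k = n ^ 2) \<longrightarrow>
            ssum VLplus1 (C2 k) = ssum (cspan {(Lm2 k ^^ s) ((Jm1 k ^^ t) Evec) | s t. True}) (C2 k))"
proof (intro conjI impI)
  \<comment> \<open>The exponent t = 0 exhibits the L(-2)-descendants of E inside the larger
    family.\<close>
  have t0: "(Lm2 k ^^ s) Evec = (Lm2 k ^^ s) ((Jm1 k ^^ 0) Evec)" for s by simp
  show "ssum VLplus1 (C2 k) = ssum (cspan {(Lm2 k ^^ s) Evec | s. True}) (C2 k)"
    using assms descendants_VLplus1[where k = k and t = 0] by (intro ssum_VLplus1_C2) auto
  show "ssum VLplus1 (C2 k) = ssum (cspan {(Lm2 k ^^ s) ((Jm1 k ^^ t) Evec) | s t. True}) (C2 k)"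
    using assms descendants_VLplus1[where k = k] t0 by (intro ssum_VLplus1_C2) blast+
qed

end
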